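(* Let $\alpha=\frac mn$ with $m,n$ coprime natural numbers and let $\rho\in(0,1)$. For $z>0$ define $$\theta=\begin{cases}\cot^{-1}\left(\cot(\pi m\rho)+(-1)^{mn}z^m\sin(\pi m\rho)^{-1}\right),&m\rho\notin\mathbb Z,\\0,&m\rho\in\mathbb Z.\end{cases}$$ Then for $z>0$ $$\begin{aligned}\phi(z;\alpha,\rho)={}&\exp\left(\frac{1}{2\pi mn}\left(\mathrm{Cl}_2(2\theta)-\mathrm{Cl}_2(2\pi m\rho)-\mathrm{Cl}_2(2\theta-2\pi m\rho)\right)\right)\\&\times\left(1+(-1)^{mn}2\cos(\pi m\rho)z^m+z^{2m}\right)^{-\frac{\rho}{2n}}\\&\times\prod_{k=0}^{n-1}\left(1+2\cos(\pi\alpha(\rho+2k+1))z^\alpha+z^{2\alpha}\right)^{\frac{n-2k-1}{2n}}\\&\times\prod_{j=0}^{m-1}\left(1+2\cos\left(\tfrac{\pi}{\alpha}(\alpha\rho+2j+1)\right)z+z^2\right)^{\frac{m-2j-1}{2m}},\end{aligned}$$ where, at points $z$ at which some factor vanishes, the right-hand side is understood by continuity.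
   Context: $\mathrm{Cl}_2(\theta)=\sum_{n\ge1}\frac{\sin(n\theta)}{n^2}$ for $\theta\in\mathbb R$ is the Clausen function (since $\mathrm{Cl}_2(2\theta)$ and $\mathrm{Cl}_2(2\theta-2\pi m\rho)$ are $\pi$-periodic in $\theta$, the choice of branch of $\cot^{-1}$ is immaterial). Definition of $\phi$. The admissible set is $\mathcal A=\{\alpha\in(0,1),\rho\in(0,1)\}\cup\{\alpha=1,\rho=\frac12\}\cup\{\alpha\in(1,2),\rho\in[1-\alpha^{-1},\alpha^{-1}]\}$. For $(\alpha,\rho)\in\mathcal A$, let $X_t$ be the stable Lévy process with $X_0=0$, $\mathbb E[e^{izX_t}]=e^{-t\Psi(z)}$, $z\in\mathbb R$, $\Psi(z)=e^{\pi i\gamma/2}|z|^\alpha$ for $z>0$, $\Psi(z)=e^{-\pi i\gamma/2}|z|^\alpha$ for $z<0$, $\gamma=\alpha(1-2\rho)$; then $\phi(z;\alpha,\rho)=\mathbb E[e^{-zS_{e(1)}}]$ for $\mathrm{Re}(z)\ge0$, where $S_t=\sup_{0\le u\le t}X_u$ and $e(1)$ is an independent unit-mean exponential variable. For general $\alpha>0$, $\rho\in(0,1)$ the function is extended by analytic continuation in the parameters: for $z>0$, $$\phi(z;\alpha,\rho)=\exp\left(\int_0^z\frac{1}{2\pi iu}\left[F(\pi i\rho-\ln u;i/\alpha)-F(-\pi i\rho-\ln u;i/\alpha)\right]du\right),\quad F(w;i/\alpha)=\int_{\mathbb R}\frac{dx}{(1+e^{w-x/\alpha})(1+e^x)}\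 (|\mathrm{Im}\,w|<\pi).$$ This agrees with the probabilistic definition when $(\alpha,\rho)\in\mathcal A$. *)

theory Defs
  imports "HOL-Analysis.Analysis"
begin

definition Cl2 :: "real \<Rightarrow> real" where
  "Cl2 \<theta> = (\<Sum>k. sin (real (Suc k) * \<theta>) / (real (Suc k))\<^sup>2)"

text \<open>
  An arbitrary, not necessarily continuous, branch of the inverse cotangent.
  The condition on the sine is needed because \<open>cot\<close> is 0 by convention at
  the multiples of \<open>pi\<close>.
\<close>

definition cot_inverse :: "(real \<Rightarrow> real) \<Rightarrow> bool" where
  "cot_inverse acot \<longleftrightarrow> (\<forall>x. sin (acot x) \<noteq> 0 \<and> cot (acot x) = x)"

text \<open>
  \<open>F w \<alpha>\<close> stands for $F(w; i/\alpha)$. The integral converges absolutely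
  for \<open>\<alpha> > 0\<close> and \<open>\<bar>Im w\<bar> < pi\<close>.
\<close>

definition F :: "complex \<Rightarrow> real \<Rightarrow> complex" where
  "F w \<alpha> = (LINT x|lborel.
     1 / ((1 + exp (w - complex_of_real (x / \<alpha>))) * (1 + exp (complex_of_real x))))"

text \<open>
  For parameters at which a stable process exists, \<open>\<phi> z \<alpha> \<rho>\<close> is the Laplace
  transform at \<open>z > 0\<close> of the supremum of the process up to an independent unit-mean
  exponential time. The formula below is its analytic continuation to all
  \<open>\<alpha> > 0\<close> and \<open>0 < \<rho> < 1\<close>; the outer integral converges absolutely.
\<close>

definition \<phi> :: "real \<Rightarrow> real \<Rightarrow> real \<Rightarrow> complex" where
  "\<phi> z \<alpha> \<rho> = exp (LINT u:{0<..<z}|lborel.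
     1 / (2 * complex_of_real pi * \<i> * complex_of_real u) *
       (F (complex_of_real pi * \<i> * complex_of_real \<rho> - complex_of_real (ln u)) \<alpha>
        - F (- (complex_of_real pi * \<i> * complex_of_real \<rho>) - complex_of_real (ln u)) \<alpha>))"

definition theta :: "(real \<Rightarrow> real) \<Rightarrow> nat \<Rightarrow> nat \<Rightarrow> real \<Rightarrow> real \<Rightarrow> real" where
  "theta acot m n \<rho> z =
     (if real m * \<rho> \<in> \<int> then 0
      else acot (cot (pi * real m * \<rho>) + (- 1) ^ (m * n) * z ^ m / sin (pi * real m * \<rho>)))"

definition factor0 :: "nat \<Rightarrow> nat \<Rightarrow> real \<Rightarrow> real \<Rightarrow> real" where
  "factor0 m n \<rho> z = 1 + (- 1) ^ (m * n) * 2 * cos (pi * real m * \<rho>) * z ^ m + z ^ (2 * m)"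

definition factor1 :: "real \<Rightarrow> real \<Rightarrow> nat \<Rightarrow> real \<Rightarrow> real" where
  "factor1 \<alpha> \<rho> k z =
     1 + 2 * cos (pi * \<alpha> * (\<rho> + 2 * real k + 1)) * z powr \<alpha> + z powr (2 * \<alpha>)"

definition factor2 :: "real \<Rightarrow> real \<Rightarrow> nat \<Rightarrow> real \<Rightarrow> real" where
  "factor2 \<alpha> \<rho> j z = 1 + 2 * cos (pi / \<alpha> * (\<alpha> * \<rho> + 2 * real j + 1)) * z + z\<^sup>2"

definition some_factor_vanishes :: "nat \<Rightarrow> nat \<Rightarrow> real \<Rightarrow> real \<Rightarrow> real \<Rightarrow> bool" where
  "some_factor_vanishes m n \<alpha> \<rho> z \<longleftrightarrow>
     factor0 m n \<rho> z = 0 \<or> (\<exists>k<n. factor1 \<alpha> \<rho> k z = 0) \<or> (\<exists>j<m. factor2 \<alpha> \<rho> j z = 0)"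

text \<open>
  Where one of the bases vanishes, the value of \<open>phi_rhs\<close> is an artefact of the
  convention \<open>0 powr a = 0\<close>, which holds even for \<open>a \<le> 0\<close>.
\<close>

definition phi_rhs ::
  "(real \<Rightarrow> real) \<Rightarrow> nat \<Rightarrow> nat \<Rightarrow> real \<Rightarrow> real \<Rightarrow> real \<Rightarrow> real" where
  "phi_rhs acot m n \<alpha> \<rho> z =
     (let \<theta> = theta acot m n \<rho> z in
       exp (1 / (2 * pi * real m * real n) *
         (Cl2 (2 * \<theta>) - Cl2 (2 * pi * real m * \<rho>) - Cl2 (2 * \<theta> - 2 * pi * real m * \<rho>)))
     * factor0 m n \<rho> z powr (- \<rho> / (2 * real n))
     * (\<Prod>k<n. factor1 \<alpha> \<rho> k z powr ((real n - 2 * real k - 1) / (2 * real n)))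
     * (\<Prod>j<m. factor2 \<alpha> \<rho> j z powr ((real m - 2 * real j - 1) / (2 * real m))))"

end

theory Submission
  imports Defs
begin

text \<open>
  The integral in the exponent of \<open>\<phi>\<close> is real: the two values of \<open>F\<close> in it are conjugate,
  and their difference is, up to a factor, the integral of
  \<open>1 / ((2 cos (pi \<rho>) + exp y + exp (- y)) (1 + exp x))\<close> with \<open>y = ln u + x / \<alpha>\<close>
  (\<open>F_difference\<close>). For \<open>\<alpha> = m/n\<close> the variable \<open>exp (x/m)\<close> makes this integrand rational. Its poles
  are the \<open>n\<close>-th roots of two conjugate numbers of modulus \<open>1/u\<close> and the \<open>m\<close>-th roots of \<open>- 1\<close>;
  they are simple for \<open>u \<noteq> 1\<close>, and partial fractions express the integral by their logarithms
  (\<open>fermi_integral_formula\<close>).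

  The product formula is verified by differentiation. Its logarithm has a derivative
  that is a sum over the same roots: logarithmic derivatives of the factors, weighted by
  the arguments of the roots. The moduli of the roots contribute a term with \<open>ln u\<close>, and
  this is the derivative of the Clausen terms, because
  \<open>Cl2' (2 \<theta>) = - ln (2 \<bar>sin \<theta>\<bar>)\<close> and the angle satisfies \<open>\<bar>sin (\<theta> - pi m \<rho>) / sin \<theta>\<bar> = z\<^sup>m\<close>
  (\<open>clausen_part_deriv\<close>, \<open>log_rhs_deriv\<close>).

  Both logarithms tend to 0 at 0, so they agree on \<open>(0, 1)\<close>. A factor can vanish only at
  \<open>z = 1\<close>, and there the derivative of the product side may be singular. The interval
  \<open>(1, \<infinity>)\<close> is reached by a symmetry instead: under \<open>z \<mapsto> 1/z\<close> each logarithm changes by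
  \<open>\<alpha> \<rho> ln z\<close> (\<open>fermi_integral_reciprocal\<close>, \<open>log_rhs_reciprocal\<close>, \<open>log_phi_eq_log_rhs\<close>). The point \<open>z = 1\<close>
  follows since \<open>\<phi>\<close> is continuous.
\<close>

section \<open>The Clausen function\<close>

lemma summable_inverse_square_Suc: "summable (\<lambda>k. 1 / (real (Suc k))\<^sup>2)"
  using inverse_power_summable[of 2, where 'a=real]
  by (subst summable_Suc_iff) (simp add: field_simps)

text \<open>
  One uniform estimate in the radius and the angle together serves twice: along
  radius 1 it gives continuity of the Clausen function, and along a fixed angle
  it gives Abel's limit from the radii below 1.
\<close>

lemma uniform_limit_Abel_Cl2:
  "uniform_limit ({0..1} \<times> UNIV) (\<lambda>n p. \<Sum>k<n. fst p ^ Suc k * sin (real (Suc k) * snd p) / (real (Suc k))\<^sup>2)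
     (\<lambda>p::real\<times>real. \<Sum>k. fst p ^ Suc k * sin (real (Suc k) * snd p) / (real (Suc k))\<^sup>2) sequentially"
proof (rule Weierstrass_m_test)
  fix k :: nat and p :: "real \<times> real" assume p: "p \<in> {0..1} \<times> UNIV"
  have "\<bar>fst p ^ Suc k * sin (real (Suc k) * snd p)\<bar> \<le> 1 * 1"
    unfolding abs_mult using p
    by (intro mult_mono) (auto simp del: power_Suc intro!: power_le_one)
  then show "norm (fst p ^ Suc k * sin (real (Suc k) * snd p) / (real (Suc k))\<^sup>2) \<le> 1 / (real (Suc k))\<^sup>2"
    by (simp add: field_simps del: power_Suc)
qed (rule summable_inverse_square_Suc)

definition Abel_Cl2 :: "real \<Rightarrow> real \<Rightarrow> real" where
  "Abel_Cl2 r t = (\<Sum>k. r ^ Suc k * sin (real (Suc k) * t) / (real (Suc k))\<^sup>2)"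

lemma Abel_Cl2_1: "Abel_Cl2 1 t = Cl2 t"
  by (simp add: Abel_Cl2_def Cl2_def)

lemma continuous_on_Abel_Cl2: "continuous_on ({0..1} \<times> UNIV) (\<lambda>p. Abel_Cl2 (fst p) (snd p))"
  unfolding Abel_Cl2_def
  by (rule uniform_limit_theorem[OF _ uniform_limit_Abel_Cl2])
     (auto intro!: continuous_intros always_eventually simp del: power_Suc of_nat_Suc)

lemma continuous_Cl2: "continuous_on UNIV Cl2"
proof -
  have "continuous_on UNIV ((\<lambda>p. Abel_Cl2 (fst p) (snd p)) \<circ> Pair 1)"
    by (rule continuous_on_compose, intro continuous_intros, rule continuous_on_subset[OF continuous_on_Abel_Cl2]) auto
  then show ?thesis by (simp add: o_def Abel_Cl2_1)
qed

lemma Abel_Cl2_tendsto: "(\<lambda>n. Abel_Cl2 (1 - 1 / real (Suc n)) t) \<longlonglongrightarrow> Cl2 t"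
proof -
  have lim: "(\<lambda>n. 1 - 1 / real (Suc n)) \<longlonglongrightarrow> 1"
    using tendsto_diff[OF tendsto_const[of 1] LIMSEQ_inverse_real_of_nat] by (simp add: inverse_eq_divide)
  have "continuous_on {0..1} ((\<lambda>p. Abel_Cl2 (fst p) (snd p)) \<circ> (\<lambda>r. (r, t)))"
    by (rule continuous_on_compose, intro continuous_intros, rule continuous_on_subset[OF continuous_on_Abel_Cl2]) auto
  from continuous_on_tendsto_compose[OF this lim] show ?thesis
    by (simp add: Abel_Cl2_1)
qed

text \<open>
  Inside the unit disc the series may be differentiated termwise, and the result
  \<open>\<Sum> r\<^sup>k cos (k t) / k\<close> is the real part of the power series of \<open>- Ln (1 - w)\<close>
  at \<open>w = r cis t\<close>.
\<close>

lemma Abel_Cl2_deriv: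
  assumes r: "0 \<le> r" "r < 1"
  shows "(Abel_Cl2 r has_field_derivative - ln (cmod (1 - rcis r t))) (at t)"
proof -
  define f' where "f' k t = r ^ Suc k * cos (real (Suc k) * t) / real (Suc k)" for k t
  have bnd: "norm (f' k t) \<le> r ^ k" for k t
  proof -
    have "\<bar>r ^ Suc k * cos (real (Suc k) * t)\<bar> \<le> r ^ k * 1"
      unfolding abs_mult using r
      by (intro mult_mono) (auto intro: mult_left_le_one_le)
    also have "\<dots> \<le> r ^ k * real (Suc k)"
      using r by (intro mult_left_mono) auto
    finally show ?thesis
      unfolding f'_def by (simp add: divide_le_eq del: power_Suc of_nat_Suc)
  qed
  have sr: "summable (\<lambda>k. r ^ k)" using r by (intro summable_geometric) auto
  have der: "((\<lambda>t. Abel_Cl2 r t) has_field_derivative (\<Sum>k. f' k t)) (at t)"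
    unfolding Abel_Cl2_def
  proof (rule has_field_derivative_series'(2)[of UNIV _ f' 0])
    show "((\<lambda>t. r ^ Suc k * sin (real (Suc k) * t) / (real (Suc k))\<^sup>2)
            has_field_derivative f' k t) (at t within UNIV)" for k t
      unfolding f'_def
      by (auto intro!: derivative_eq_intros simp: power2_eq_square divide_simps simp del: power_Suc of_nat_Suc)
    show "uniformly_convergent_on UNIV (\<lambda>n t. \<Sum>i<n. f' i t)"
      by (rule uniformly_convergentI[OF Weierstrass_m_test[OF _ sr]]) (use bnd in auto)
  qed auto
  have n: "cmod (- rcis r t) < 1" using r by simp
  have "(\<lambda>k. - ((rcis r t) ^ k) / of_nat k) sums ln (1 - rcis r t)"
    using Ln_series'[OF n] by simp
  then have "(\<lambda>k. Re (- ((rcis r t) ^ k) / of_nat k)) sums Re (ln (1 - rcis r t))"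
    by (rule sums_Re)
  moreover have "Re (ln (1 - rcis r t)) = ln (cmod (1 - rcis r t))"
    using n by (intro Re_Ln) (metis eq_iff_diff_eq_0 norm_minus_cancel norm_one less_irrefl)
  moreover have "(\<lambda>k. Re (- ((rcis r t) ^ k) / of_nat k)) = (\<lambda>k. - (r ^ k * cos (real k * t) / real k))"
    unfolding DeMoivre2 by (simp add: Re_divide_of_nat)
  ultimately have "(\<lambda>k. - (r ^ k * cos (real k * t) / real k)) sums ln (cmod (1 - rcis r t))" by simp
  then have "(\<lambda>k. - (r ^ Suc k * cos (real (Suc k) * t) / real (Suc k))) sums ln (cmod (1 - rcis r t))"
    by (subst sums_Suc_iff) simp
  from sums_minus[OF this] have "(\<Sum>k. f' k t) = - ln (cmod (1 - rcis r t))"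
    unfolding f'_def by (simp add: sums_iff)
  with der show ?thesis by simp
qed

lemma abs_ln_diff_le:
  fixes x y c :: real
  assumes "0 < c" "c \<le> x" "c \<le> y"
  shows "\<bar>ln x - ln y\<bar> \<le> \<bar>x - y\<bar> / c"
proof -
  have *: "ln x - ln y \<le> \<bar>x - y\<bar> / c" if "c \<le> x" "c \<le> y" for x y
  proof -
    have "ln x - ln y \<le> (x - y) / y" using that assms by (intro ln_diff_le) auto
    also have "\<dots> \<le> \<bar>x - y\<bar> / c" using that assms by (intro frac_le) auto
    finally show ?thesis .
  qed
  from *[of x y] *[of y x] assms show ?thesis by (auto simp: abs_le_iff abs_minus_commute)
qed

text \<open>
  On the boundary the differentiated series converges only conditionally, so
  termwise differentiation is unavailable. Instead the derivatives for radius
  \<open>r < 1\<close> are explicit logarithms \<open>- ln \<bar>1 - r cis t\<bar>\<close>, and as \<open>r\<close> tends to 1 these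
  converge uniformly near every angle at which \<open>\<bar>1 - cis t\<bar> = 2 \<bar>sin (t/2)\<bar>\<close> does not
  vanish.
\<close>

lemma Cl2_deriv:
  assumes t: "sin (t / 2) \<noteq> 0"
  shows "(Cl2 has_field_derivative - ln (2 * \<bar>sin (t / 2)\<bar>)) (at t)"
proof -
  define d where "d s = cmod (1 - cis s)" for s
  have d: "d s = 2 * \<bar>sin (s / 2)\<bar>" for s
  proof -
    have "(d s)\<^sup>2 = (1 - cos s)\<^sup>2 + (sin s)\<^sup>2"
      by (simp add: d_def cmod_def)
    also have "\<dots> = 2 - 2 * cos s"
      using sin_cos_squared_add[of s] by (simp add: power2_eq_square algebra_simps)
    also have "\<dots> = (2 * \<bar>sin (s / 2)\<bar>)\<^sup>2"
      using cos_double_sin[of "s/2"] by (simp add: power_mult_distrib)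
    finally show ?thesis by (subst (asm) power2_eq_iff_nonneg) (auto simp: d_def)
  qed
  have dt: "d t > 0" using t by (simp add: d)
  have "continuous_on UNIV d" unfolding d by (intro continuous_intros) auto
  then have "isCont d t" by (simp add: continuous_on_eq_continuous_at)
  then have "eventually (\<lambda>s. d s > d t / 2) (nhds t)"
    using dt order_tendstoD(1)[of d "d t" "nhds t" "d t / 2"]
    by (simp add: isCont_def tendsto_at_iff_tendsto_nhds)
  then obtain e where e: "e > 0" "\<And>s. dist s t < e \<Longrightarrow> d s > d t / 2"
    by (auto simp: eventually_nhds_metric)
  define r where "r n = 1 - 1 / real (Suc n)" for n
  have rlim: "r \<longlonglongrightarrow> 1" unfolding r_def
    using tendsto_diff[OF tendsto_const[of 1] LIMSEQ_inverse_real_of_nat] by (simp add: inverse_eq_divide)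
  have r01: "0 \<le> r n" "r n < 1" for n by (auto simp: r_def)
  have rd: "\<bar>cmod (1 - rcis (r n) s) - d s\<bar> \<le> 1 - r n" for n s
  proof -
    have "\<bar>cmod (1 - rcis (r n) s) - d s\<bar> \<le> cmod ((1 - rcis (r n) s) - (1 - cis s))"
      unfolding d_def by (rule norm_triangle_ineq3)
    also have "(1 - rcis (r n) s) - (1 - cis s) = of_real (1 - r n) * cis s"
      by (simp add: rcis_def algebra_simps)
    also have "cmod \<dots> = 1 - r n" using r01[of n] by (simp add: norm_mult del: of_real_diff)
    finally show ?thesis .
  qed
  have "\<exists>g. \<forall>s\<in>ball t e. (\<lambda>n. Abel_Cl2 (r n) s) \<longlonglongrightarrow> g s \<and>
      (g has_derivative (\<lambda>h. - ln (d s) * h)) (at s within ball t e)"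
  proof (rule has_derivative_sequence[where f' = "\<lambda>n s h. - ln (cmod (1 - rcis (r n) s)) * h" and ?x0.0 = t])
    show "((\<lambda>s. Abel_Cl2 (r n) s) has_derivative (\<lambda>h. - ln (cmod (1 - rcis (r n) s)) * h)) (at s within ball t e)" for n s
      using Abel_Cl2_deriv[OF r01, of n s] unfolding has_field_derivative_def
      by (rule has_derivative_at_withinI)
    show "(\<lambda>n. Abel_Cl2 (r n) t) \<longlonglongrightarrow> Cl2 t" unfolding r_def by (rule Abel_Cl2_tendsto)
    fix \<epsilon> :: real assume "\<epsilon> > 0"
    \<comment> \<open>On the ball \<open>d\<close> exceeds \<open>2 c\<close>; a radius within \<open>c\<close> of 1 keeps the perturbed modulus above \<open>c\<close>.\<close>
    define c where "c = d t / 4"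
    have "c > 0" using dt by (simp add: c_def)
    then have "min c (\<epsilon> * c) > 0" using \<open>\<epsilon> > 0\<close> by simp
    then have "eventually (\<lambda>n. r n > 1 - min c (\<epsilon> * c)) sequentially"
      by (intro order_tendstoD(1)[OF rlim]) linarith
    then show "\<forall>\<^sub>F n in sequentially. \<forall>s\<in>ball t e. \<forall>h. norm (- ln (cmod (1 - rcis (r n) s)) * h - - ln (d s) * h) \<le> \<epsilon> * norm h"
    proof eventually_elim
      case (elim n)
      show ?case
      proof (intro ballI allI)
        fix s h assume "s \<in> ball t e"
        then have ds: "d s > 2 * c" using e(2)[of s] by (simp add: c_def dist_commute)
        have "\<bar>ln (d s) - ln (cmod (1 - rcis (r n) s))\<bar> \<le> \<bar>d s - cmod (1 - rcis (r n) s)\<bar> / c"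
          using rd[of n s] elim ds \<open>c > 0\<close> by (intro abs_ln_diff_le) linarith+
        also have "\<dots> \<le> (1 - r n) / c"
          using rd[of n s] \<open>c > 0\<close> by (intro divide_right_mono) (auto simp: abs_minus_commute)
        also have "\<dots> \<le> \<epsilon>" using elim \<open>c > 0\<close> by (simp add: field_simps)
        finally have "\<bar>ln (d s) - ln (cmod (1 - rcis (r n) s))\<bar> \<le> \<epsilon>" .
        then have "\<bar>ln (d s) - ln (cmod (1 - rcis (r n) s))\<bar> * \<bar>h\<bar> \<le> \<epsilon> * \<bar>h\<bar>"
          by (rule mult_right_mono) simp
        then show "norm (- ln (cmod (1 - rcis (r n) s)) * h - - ln (d s) * h) \<le> \<epsilon> * norm h"
          by (simp add: abs_mult[symmetric] algebra_simps)
      qed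
    qed
  qed (use e in auto)
  then obtain g where g: "\<And>s. s \<in> ball t e \<Longrightarrow> (\<lambda>n. Abel_Cl2 (r n) s) \<longlonglongrightarrow> g s"
      "\<And>s. s \<in> ball t e \<Longrightarrow> (g has_derivative (\<lambda>h. - ln (d s) * h)) (at s within ball t e)" by blast
  have gC: "g s = Cl2 s" if "s \<in> ball t e" for s
    using LIMSEQ_unique[OF g(1)[OF that]] Abel_Cl2_tendsto[of s] unfolding r_def by blast
  have "(g has_field_derivative - ln (d t)) (at t within ball t e)"
    unfolding has_field_derivative_def by (rule g(2)) (use e(1) in simp)
  then have "(g has_field_derivative - ln (d t)) (at t)"
    using e(1) at_within_open[of t "ball t e"] by simp
  then have "(Cl2 has_field_derivative - ln (d t)) (at t)"
    by (rule has_field_derivative_transform_within_open[of _ _ _ "ball t e"]) (use e gC in auto)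
  then show ?thesis by (simp add: d)
qed

lemma Cl2_minus: "Cl2 (- t) = - Cl2 t"
proof -
  have "summable (\<lambda>k. sin (real (Suc k) * t) / (real (Suc k))\<^sup>2)"
  proof (rule summable_comparison_test)
    show "\<exists>N. \<forall>k\<ge>N. norm (sin (real (Suc k) * t) / (real (Suc k))\<^sup>2) \<le> 1 / (real (Suc k))\<^sup>2"
      by (auto simp: divide_simps)
  qed (rule summable_inverse_square_Suc)
  from suminf_minus[OF this] show ?thesis by (simp add: Cl2_def del: of_nat_Suc)
qed

lemma Cl2_0: "Cl2 0 = 0" by (simp add: Cl2_def)

lemma Cl2_periodic:
  assumes "k \<in> \<int>" shows "Cl2 (t + 2 * pi * k) = Cl2 t"
proof -
  from assms obtain i where k: "k = of_int i" by (auto elim: Ints_cases)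
  have "sin (real (Suc j) * (t + 2 * pi * k)) = sin (real (Suc j) * t)" for j
    using sin.plus_of_int[of "real (Suc j) * t" "int (Suc j) * i"]
    by (simp add: k algebra_simps)
  then show ?thesis by (simp add: Cl2_def del: of_nat_Suc)
qed

section \<open>Sums over roots of unity\<close>

lemma sum_powers_primitive_root:
  fixes n r j :: nat
  assumes "coprime r n" "0 < j" "j < n"
  shows "(\<Sum>k<n. cis (2 * pi * real r / real n) ^ (k * j)) = 0"
proof -
  define x where "x = cis (2 * pi * real r / real n) ^ j"
  have "x \<noteq> 1"
  proof
    assume "x = 1"
    then have "cis (2 * pi * (real r * real j / real n)) = 1"
      unfolding x_def Complex.DeMoivre by (simp add: mult_ac)
    then have "cos (2 * pi * (real r * real j / real n)) = 1" by (simp add: complex_eq_iff)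
    then obtain i :: int where "2 * pi * (real r * real j / real n) = real_of_int i * 2 * pi"
      using cos_one_2pi_int by blast
    then have "real (r * j) = real_of_int (i * int n)" using assms by (simp add: field_simps)
    then have "int (r * j) = i * int n" by (metis of_int_eq_iff of_int_of_nat_eq)
    then have "int n dvd int (r * j)" by (metis dvd_triv_right)
    then have "n dvd r * j" by (subst (asm) int_dvd_int_iff)
    then have "n dvd j" using assms by (metis coprime_commute coprime_dvd_mult_right_iff)
    with assms show False by (auto dest: dvd_imp_le)
  qed
  moreover have "x ^ n = 1"
  proof -
    have "x ^ n = (cis (2 * pi * real r / real n) ^ n) ^ j"
      unfolding x_def by (simp add: power_mult[symmetric] mult.commute)
    also have "cis (2 * pi * real r / real n) ^ n = 1"
      using assms unfolding Complex.DeMoivre by simp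
    finally show ?thesis by simp
  qed
  moreover have "(\<Sum>k<n. cis (2 * pi * real r / real n) ^ (k * j)) = (\<Sum>k<n. x ^ k)"
    by (simp add: x_def power_mult[symmetric] mult.commute)
  ultimately show ?thesis by (simp add: geometric_sum)
qed

text \<open>
  Multiplying each summand by \<open>1 - x\<^sup>n\<close> turns it into a finite geometric sum; summed
  over the roots of unity only the constant terms survive.
\<close>

lemma sum_inverse_one_minus_roots:
  fixes n r :: nat and x :: complex
  assumes "n > 0" "coprime r n" "x ^ n \<noteq> 1"
  defines "\<omega> \<equiv> cis (2 * pi * real r / real n)"
  shows "(\<Sum>k<n. 1 / (1 - x * \<omega> ^ k)) = of_nat n / (1 - x ^ n)"
proof -
  have wn: "(x * \<omega> ^ k) ^ n = x ^ n" for k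
  proof -
    have "\<omega> ^ n = 1" using \<open>n > 0\<close> unfolding \<omega>_def Complex.DeMoivre by simp
    then show ?thesis by (simp add: power_mult_distrib power_mult[symmetric] mult.commute[of k]) (simp add: power_mult)
  qed
  then have ne: "x * \<omega> ^ k \<noteq> 1" for k using assms(3) by (metis power_one)
  have "1 / (1 - x * \<omega> ^ k) = (\<Sum>j<n. x ^ j * \<omega> ^ (k * j)) / (1 - x ^ n)" for k
  proof -
    have "1 - x ^ n = (1 - x * \<omega> ^ k) * (\<Sum>j<n. (x * \<omega> ^ k) ^ j)"
      using one_diff_power_eq[of "x * \<omega> ^ k" n] by (simp only: wn)
    also have "(\<Sum>j<n. (x * \<omega> ^ k) ^ j) = (\<Sum>j<n. x ^ j * \<omega> ^ (k * j))"
      by (simp add: power_mult_distrib power_mult)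
    finally have eq: "1 - x ^ n = (1 - x * \<omega> ^ k) * (\<Sum>j<n. x ^ j * \<omega> ^ (k * j))" .
    moreover have "1 - x ^ n \<noteq> 0" using assms(3) by simp
    ultimately show ?thesis using ne[of k] by (metis mult_eq_0_iff nonzero_divide_mult_cancel_right)
  qed
  then have "(\<Sum>k<n. 1 / (1 - x * \<omega> ^ k)) = (\<Sum>k<n. \<Sum>j<n. x ^ j * \<omega> ^ (k * j)) / (1 - x ^ n)"
    by (simp add: sum_divide_distrib)
  also have "(\<Sum>k<n. \<Sum>j<n. x ^ j * \<omega> ^ (k * j)) = (\<Sum>j<n. x ^ j * (\<Sum>k<n. \<omega> ^ (k * j)))"
    by (subst sum.swap) (simp add: sum_distrib_left)
  also have "\<dots> = (\<Sum>j<n. if j = 0 then of_nat n else 0)"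
    using sum_powers_primitive_root[OF assms(2)] by (intro sum.cong) (auto simp: \<omega>_def)
  also have "\<dots> = of_nat n" using \<open>n > 0\<close> by (simp add: sum.delta)
  finally show ?thesis .
qed

text \<open>
  This is \<open>y\<close> times the logarithmic derivative of \<open>y\<^sup>n - a\<close>, where \<open>a = p0\<^sup>n\<close> and the
  roots of the polynomial are the rotations of \<open>p0\<close>.
\<close>

lemma sum_inverse_diff_roots:
  fixes n :: nat and p0 y :: complex
  assumes "n > 0" "p0 \<noteq> 0" "y ^ n \<noteq> p0 ^ n"
  defines "\<omega> \<equiv> cis (2 * pi / real n)"
  shows "(\<Sum>k<n. y / (y - p0 * \<omega> ^ k)) = of_nat n * y ^ n / (y ^ n - p0 ^ n)"
proof (cases "y = 0")
  case True with \<open>n > 0\<close> show ?thesis by simp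
next
  case False
  have "(\<Sum>k<n. 1 / (1 - (p0 / y) * \<omega> ^ k)) = of_nat n / (1 - (p0 / y) ^ n)"
    using sum_inverse_one_minus_roots[of n 1 "p0 / y"] assms False by (auto simp: power_divide)
  moreover have "1 / (1 - (p0 / y) * \<omega> ^ k) = y / (y - p0 * \<omega> ^ k)" for k
    using False by (simp add: divide_simps)
  moreover have "of_nat n / (1 - (p0 / y) ^ n) = of_nat n * y ^ n / (y ^ n - p0 ^ n)"
    using False by (simp add: power_divide divide_simps)
  ultimately show ?thesis by simp
qed

section \<open>The exponent as a real integral\<close>

lemma integral_FTC_nonneg_real_line:
  fixes f G :: "real \<Rightarrow> real"
  assumes "\<And>x. (G has_field_derivative f x) (at x)" "\<And>x. isCont f x" "\<And>x. 0 \<le> f x"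
    and "(G \<longlongrightarrow> A) at_bot" "(G \<longlongrightarrow> B) at_top"
  shows "integrable lborel f" "(LINT x|lborel. f x) = B - A"
proof -
  have *: "set_integrable lborel (einterval (-\<infinity>) \<infinity>) f" "(LBINT x=-\<infinity>..\<infinity>. f x) = B - A"
    by (rule interval_integral_FTC_nonneg[of "-\<infinity>" \<infinity> G f A B]; use assms in \<open>simp add: ereal_tendsto_simps\<close>)+
  show "integrable lborel f" using *(1) by (simp add: set_integrable_def)
  show "(LINT x|lborel. f x) = B - A" using *(2)
    by (simp add: interval_lebesgue_integral_def set_lebesgue_integral_def)
qed

text \<open>
  Up to the factor \<open>- sin (pi \<rho>)\<close>, this is the imaginary part of
  \<open>1 / (1 + exp (i pi \<rho> - y))\<close>; it is what remains of the integrand of \<open>F\<close> after the two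
  conjugate values are subtracted.
\<close>

definition kern :: "real \<Rightarrow> real \<Rightarrow> real" where
  "kern \<rho> y = 1 / (2 * cos (pi * \<rho>) + exp y + exp (- y))"

lemma sin_pi_pos: "0 < \<rho> \<Longrightarrow> \<rho> < 1 \<Longrightarrow> sin (pi * \<rho>) > 0"
  by (intro sin_gt_zero) auto

lemma kern_denom_pos:
  assumes "0 < \<rho>" "\<rho> < 1"
  shows "2 * cos (pi * \<rho>) + exp y + exp (- y) > (0::real)"
proof -
  have "cos (pi * \<rho>) > -1" using assms cos_monotone_0_pi[of "pi * \<rho>" pi] by simp
  moreover have "exp y + exp (- y) \<ge> 2"
  proof -
    have "(exp (y/2) - exp (-y/2))\<^sup>2 \<ge> 0" by simp
    also have "(exp (y/2) - exp (-y/2))\<^sup>2 = exp y + exp (-y) - 2"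
      by (simp add: power2_eq_square algebra_simps exp_add[symmetric])
    finally show ?thesis by simp
  qed
  ultimately show ?thesis by linarith
qed

lemma kern_pos: "0 < \<rho> \<Longrightarrow> \<rho> < 1 \<Longrightarrow> kern \<rho> y > 0"
  using kern_denom_pos by (simp add: kern_def)

lemma kern_minus: "kern \<rho> (- y) = kern \<rho> y"
  by (simp add: kern_def add_ac)

lemma continuous_kern: "0 < \<rho> \<Longrightarrow> \<rho> < 1 \<Longrightarrow> continuous_on UNIV (kern \<rho>)"
  unfolding kern_def using kern_denom_pos[of \<rho>] by (intro continuous_intros) (metis less_irrefl)

lemma kern_measurable [measurable]: "kern \<rho> \<in> borel_measurable borel"
  unfolding kern_def by measurable

text \<open>
  An antiderivative is \<open>arctan ((exp y + cos (pi \<rho>)) / sin (pi \<rho>)) / sin (pi \<rho>)\<close>. At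
  \<open>- \<infinity>\<close> the argument tends to \<open>cot (pi \<rho>) = tan (pi/2 - pi \<rho>)\<close>.
\<close>

lemma kern_integral:
  assumes "0 < \<rho>" "\<rho> < 1"
  shows "integrable lborel (kern \<rho>)" "(LINT y|lborel. kern \<rho> y) = pi * \<rho> / sin (pi * \<rho>)"
proof -
  define s c where "s = sin (pi * \<rho>)" and "c = cos (pi * \<rho>)"
  have s: "s > 0" using sin_pi_pos[OF assms] by (simp add: s_def)
  have sc: "s\<^sup>2 + c\<^sup>2 = 1" by (simp add: s_def c_def)
  define G where "G y = arctan ((exp y + c) / s) / s" for y :: real
  have 1: "(G has_field_derivative kern \<rho> y) (at y)" for y
  proof -
    have p: "1 + ((exp y + c) / s)\<^sup>2 > 0" by (simp add: add_pos_nonneg)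
    have "(G has_field_derivative (inverse (1 + ((exp y + c) / s)\<^sup>2) * (exp y / s)) / s) (at y)"
      unfolding G_def using s
      by (intro DERIV_cdivide DERIV_chain2[OF DERIV_arctan]) (auto intro!: derivative_eq_intros)
    also have "(inverse (1 + ((exp y + c) / s)\<^sup>2) * (exp y / s)) / s = exp y / (s\<^sup>2 * (1 + ((exp y + c) / s)\<^sup>2))"
      by (simp add: divide_inverse power2_eq_square mult_ac)
    also have "s\<^sup>2 * (1 + ((exp y + c) / s)\<^sup>2) = s\<^sup>2 + (exp y + c)\<^sup>2"
      using s by (simp add: power_divide distrib_left)
    also have "s\<^sup>2 + (exp y + c)\<^sup>2 = exp y * (2 * c + exp y + exp (- y))"
      using sc by (simp add: power2_eq_square algebra_simps exp_minus)
    also have "exp y / \<dots> = kern \<rho> y" by (simp add: kern_def c_def)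
    finally show ?thesis .
  qed
  have 2: "isCont (kern \<rho>) y" for y
    using continuous_kern[OF assms] by (simp add: continuous_on_eq_continuous_at)
  have "((\<lambda>y. (exp y + c) / s) \<longlongrightarrow> (0 + c) / s) at_bot"
    using s by (intro tendsto_intros exp_at_bot) auto
  then have "(G \<longlongrightarrow> arctan ((0 + c) / s) / s) at_bot"
    unfolding G_def using s by (auto intro!: tendsto_divide[OF tendsto_arctan tendsto_const])
  also have "arctan ((0 + c) / s) = pi / 2 - pi * \<rho>"
  proof -
    have "c / s = tan (pi / 2 - pi * \<rho>)"
      by (simp add: tan_def s_def c_def cos_diff sin_diff)
    then show ?thesis
      by simp (intro arctan_tan; use assms in \<open>simp add: field_simps\<close>)
  qed
  finally have 3: "(G \<longlongrightarrow> (pi / 2 - pi * \<rho>) / s) at_bot" .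
  have "filterlim (\<lambda>y. (c + exp y) * inverse s) at_top at_top"
    using s by (intro filterlim_at_top_mult_tendsto_pos[OF tendsto_const]
          filterlim_tendsto_add_at_top[OF tendsto_const exp_at_top]) auto
  then have "filterlim (\<lambda>y. (exp y + c) / s) at_top at_top"
    by (simp add: divide_inverse add.commute)
  then have 4: "(G \<longlongrightarrow> (pi / 2) / s) at_top"
    unfolding G_def using s by (intro tendsto_intros filterlim_compose[OF tendsto_arctan_at_top]) auto
  note R = integral_FTC_nonneg_real_line[OF 1 2 less_imp_le[OF kern_pos[OF assms]] 3 4]
  show "integrable lborel (kern \<rho>)" by (rule R)
  show "(LINT y|lborel. kern \<rho> y) = pi * \<rho> / sin (pi * \<rho>)"
    using R(2) by (simp add: s_def diff_divide_distrib)
qed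

definition fermi_integral :: "real \<Rightarrow> real \<Rightarrow> real \<Rightarrow> real" where
  "fermi_integral \<alpha> \<rho> u = (LINT x|lborel. kern \<rho> (ln u + x / \<alpha>) / (1 + exp x))"

lemma fermi_integrand_integrable:
  assumes "0 < \<rho>" "\<rho> < 1" "\<alpha> > 0"
  shows "integrable lborel (\<lambda>x. kern \<rho> (t + x / \<alpha>) / (1 + exp x))"
proof (rule Bochner_Integration.integrable_bound)
  show "integrable lborel (\<lambda>x. kern \<rho> (t + (1 / \<alpha>) * x))"
    using assms by (intro lborel_integrable_real_affine kern_integral) auto
  show "AE x in lborel. norm (kern \<rho> (t + x / \<alpha>) / (1 + exp x)) \<le> norm (kern \<rho> (t + 1 / \<alpha> * x))"
    using kern_pos[OF assms(1,2)]
    by (intro always_eventually allI) (auto simp: abs_mult divide_le_eq algebra_simps less_imp_le add_pos_pos)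
qed simp

lemma fermi_integral_nonneg:
  assumes "0 < \<rho>" "\<rho> < 1"
  shows "fermi_integral \<alpha> \<rho> u \<ge> 0"
  unfolding fermi_integral_def using less_imp_le[OF kern_pos[OF assms]]
  by (intro integral_nonneg_AE always_eventually allI divide_nonneg_nonneg) (auto intro: add_nonneg_nonneg)

text \<open>
  Replacing \<open>x\<close> by \<open>- x\<close> and using that the kernel is even turns the weight
  \<open>1 / (1 + exp x)\<close> into the complementary weight \<open>1 / (1 + exp (- x))\<close>. The two weights
  add up to 1, so the sum is the integral of the kernel alone.
\<close>

lemma fermi_integral_reciprocal:
  assumes "0 < \<rho>" "\<rho> < 1" "\<alpha> > 0" "u > 0"
  shows "fermi_integral \<alpha> \<rho> u + fermi_integral \<alpha> \<rho> (1 / u) = \<alpha> * (pi * \<rho> / sin (pi * \<rho>))"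
proof -
  have "fermi_integral \<alpha> \<rho> (1 / u) = (LINT x|lborel. kern \<rho> (ln (1 / u) + (0 + (-1) * x) / \<alpha>) / (1 + exp (0 + (-1) * x)))"
    unfolding fermi_integral_def by (subst lborel_integral_real_affine[where c = "-1" and t = 0]) auto
  also have "\<dots> = (LINT x|lborel. kern \<rho> (ln u + x / \<alpha>) / (1 + exp (- x)))"
    using assms kern_minus[of \<rho> "ln u + x / \<alpha>" for x]
    by (intro Bochner_Integration.integral_cong) (auto simp: ln_div algebra_simps)
  finally have 1: "fermi_integral \<alpha> \<rho> (1 / u) = (LINT x|lborel. kern \<rho> (ln u + x / \<alpha>) / (1 + exp (- x)))" .
  have eq: "1 / (1 + exp (- x)) = 1 - 1 / (1 + exp x)" for x :: real
    by (simp add: exp_minus divide_simps add_pos_pos) (smt (verit) exp_gt_zero)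
  have K: "integrable lborel (\<lambda>x. kern \<rho> (ln u + (1 / \<alpha>) * x))"
    using assms by (intro lborel_integrable_real_affine kern_integral) auto
  have "(\<lambda>x. kern \<rho> (ln u + x / \<alpha>) / (1 + exp (- x)))
      = (\<lambda>x. kern \<rho> (ln u + (1 / \<alpha>) * x) - kern \<rho> (ln u + x / \<alpha>) / (1 + exp x))"
  proof
    fix x show "kern \<rho> (ln u + x / \<alpha>) / (1 + exp (- x)) = kern \<rho> (ln u + (1 / \<alpha>) * x) - kern \<rho> (ln u + x / \<alpha>) / (1 + exp x)"
      using arg_cong[OF eq[of x], of "\<lambda>q. kern \<rho> (ln u + x / \<alpha>) * q"] by (simp add: algebra_simps)
  qed
  then have "fermi_integral \<alpha> \<rho> (1 / u) = (LINT x|lborel. kern \<rho> (ln u + (1 / \<alpha>) * x)) - fermi_integral \<alpha> \<rho> u"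
    unfolding 1 fermi_integral_def[of \<alpha> \<rho> u]
    by (simp only: Bochner_Integration.integral_diff[OF K fermi_integrand_integrable[OF assms(1-3), of "ln u"]])
  moreover have "(LINT y|lborel. kern \<rho> y) = \<bar>1 / \<alpha>\<bar> *\<^sub>R (LINT x|lborel. kern \<rho> (ln u + (1 / \<alpha>) * x))"
    using assms by (intro lborel_integral_real_affine) auto
  ultimately show ?thesis using assms by (simp add: kern_integral field_simps)
qed

text \<open>
  A shift of the integration variable moves the dependence on \<open>u\<close> from the kernel into
  the bounded weight, so that the kernel itself dominates.
\<close>

lemma continuous_fermi_integral:
  assumes "0 < \<rho>" "\<rho> < 1" "\<alpha> > 0"
  shows "continuous_on {0<..} (fermi_integral \<alpha> \<rho>)"
proof -
  have fermi_integral: "fermi_integral \<alpha> \<rho> u = \<alpha> * (LINT y|lborel. kern \<rho> y / (1 + exp (\<alpha> * (y - ln u))))" for u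
    unfolding fermi_integral_def using assms
    by (subst lborel_integral_real_affine[where c = \<alpha> and t = "- \<alpha> * ln u"])
       (auto simp: diff_divide_distrib right_diff_distrib add_divide_distrib)
  have "isCont (\<lambda>u. LINT y|lborel. kern \<rho> y / (1 + exp (\<alpha> * (y - ln u)))) u" if "u > 0" for u
  proof (rule continuous_at_sequentiallyI)
    fix v assume v: "v \<longlonglongrightarrow> u"
    show "(\<lambda>n. LINT y|lborel. kern \<rho> y / (1 + exp (\<alpha> * (y - ln (v n))))) \<longlonglongrightarrow> (LINT y|lborel. kern \<rho> y / (1 + exp (\<alpha> * (y - ln u))))"
    proof (rule integral_dominated_convergence[where w = "kern \<rho>"])
      show "integrable lborel (kern \<rho>)" by (rule kern_integral[OF assms(1,2)])
      show "AE y in lborel. (\<lambda>n. kern \<rho> y / (1 + exp (\<alpha> * (y - ln (v n))))) \<longlonglongrightarrow> kern \<rho> y / (1 + exp (\<alpha> * (y - ln u)))"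
        using that by (intro always_eventually allI tendsto_intros v) (auto simp: add_pos_pos less_imp_neq[symmetric])
      show "AE y in lborel. norm (kern \<rho> y / (1 + exp (\<alpha> * (y - ln (v n))))) \<le> kern \<rho> y" for n
        using kern_pos[OF assms(1,2)]
        by (intro always_eventually allI) (auto simp: divide_le_eq algebra_simps less_imp_le add_pos_pos)
    qed simp_all
  qed
  then show ?thesis unfolding fermi_integral
    by (intro continuous_intros continuous_at_imp_continuous_on) auto
qed

text \<open>
  The arguments of the two values of \<open>F\<close> are conjugate, so their difference is
  \<open>2 i Im (F w)\<close>, and the imaginary part may be taken under the integral. Integrability
  rests on \<open>\<bar>1 + a cis (pi \<rho>)\<bar> \<ge> max 1 a * sin (pi \<rho>)\<close> for \<open>a > 0\<close>.
\<close>

lemma F_difference: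
  assumes "0 < \<rho>" "\<rho> < 1" "\<alpha> > 0" "u > 0"
  shows "1 / (2 * complex_of_real pi * \<i> * complex_of_real u) *
       (F (complex_of_real pi * \<i> * complex_of_real \<rho> - complex_of_real (ln u)) \<alpha>
        - F (- (complex_of_real pi * \<i> * complex_of_real \<rho>) - complex_of_real (ln u)) \<alpha>)
     = complex_of_real (- sin (pi * \<rho>) / (pi * u) * fermi_integral \<alpha> \<rho> u)"
proof -
  define w where "w = complex_of_real pi * \<i> * complex_of_real \<rho> - complex_of_real (ln u)"
  define s where "s = sin (pi * \<rho>)"
  have s: "s > 0" using sin_pi_pos[OF assms(1,2)] by (simp add: s_def)
  define h where "h w x = 1 / ((1 + exp (w - complex_of_real (x / \<alpha>))) * (1 + exp (complex_of_real x)))" for w x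
  define a where "a x = exp (- (ln u + x / \<alpha>))" for x
  have ap: "a x > 0" for x by (simp add: a_def)
  have ew: "exp (w - complex_of_real (x / \<alpha>)) = complex_of_real (a x) * cis (pi * \<rho>)" for x
    unfolding w_def a_def exp_of_real[symmetric] cis_conv_exp exp_add[symmetric]
    by (simp add: algebra_simps)
  have hw: "h w x = 1 / (1 + complex_of_real (a x) * cis (pi * \<rho>)) * complex_of_real (1 / (1 + exp x))" for x
    unfolding h_def ew exp_of_real by simp
  have b1: "cmod (1 + complex_of_real (a x) * cis (pi * \<rho>)) \<ge> a x * s" for x
    using abs_Im_le_cmod[of "1 + complex_of_real (a x) * cis (pi * \<rho>)"] ap[of x] s by (simp add: s_def)
  have b2: "cmod (1 + complex_of_real (a x) * cis (pi * \<rho>)) \<ge> s" for x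
  proof -
    have "1 + complex_of_real (a x) * cis (pi * \<rho>) = cis (pi * \<rho>) * (complex_of_real (a x) + cis (- (pi * \<rho>)))"
      by (simp add: algebra_simps cis_mult)
    then have "cmod (1 + complex_of_real (a x) * cis (pi * \<rho>)) = cmod (complex_of_real (a x) + cis (- (pi * \<rho>)))"
      by (simp add: norm_mult)
    also have "\<dots> \<ge> s" using abs_Im_le_cmod[of "complex_of_real (a x) + cis (- (pi * \<rho>))"] s by (simp add: s_def)
    finally show ?thesis .
  qed
  have ne: "1 + complex_of_real (a x) * cis (pi * \<rho>) \<noteq> 0" for x
    using b2[of x] s by auto
  have hint: "integrable lborel (h w)"
  proof (rule Bochner_Integration.integrable_bound)
    \<comment> \<open>The integrand decays like \<open>exp (- x)\<close> on the right and like \<open>exp (x / \<alpha>)\<close> on the left; the kernel for \<open>\<rho> = 1/2\<close> is a majorant with the slower of the two rates.\<close>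
    define \<kappa> where "\<kappa> = min 1 (1 / \<alpha>)"
    have \<kappa>: "\<kappa> > 0" "\<kappa> \<le> 1" "\<kappa> \<le> 1 / \<alpha>" using assms by (auto simp: \<kappa>_def)
    show "integrable lborel (\<lambda>x. 2 * max 1 u / s * kern (1/2) (0 + \<kappa> * x))"
      using \<kappa> by (intro integrable_mult_right lborel_integrable_real_affine kern_integral) auto
    have "continuous_on UNIV (\<lambda>x. 1 + exp (w - complex_of_real (x / \<alpha>)))"
      using assms by (intro continuous_intros) auto
    then show "h w \<in> borel_measurable lborel" unfolding h_def
      by (intro borel_measurable_divide borel_measurable_times borel_measurable_const)
         (auto intro!: borel_measurable_continuous_onI continuous_intros)
    show "AE x in lborel. norm (h w x) \<le> norm (2 * max 1 u / s * kern (1/2) (0 + \<kappa> * x))"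
    proof (intro always_eventually allI)
      fix x :: real
      define D where "D = cmod (1 + complex_of_real (a x) * cis (pi * \<rho>))"
      have n: "norm (h w x) = 1 / D * (1 / (1 + exp x))"
        unfolding hw norm_mult D_def by (simp add: norm_divide add_pos_pos less_imp_le del: of_real_divide of_real_add)
      have D: "D \<ge> s" "D \<ge> a x * s" using b1 b2 by (auto simp: D_def)
      have "norm (h w x) \<le> max 1 u / s * exp (- (\<kappa> * \<bar>x\<bar>))"
      proof (cases "x \<ge> 0")
        case True
        have "1 / D * (1 / (1 + exp x)) \<le> 1 / s * (1 / exp x)"
          using D s by (intro mult_mono divide_left_mono) (auto intro!: mult_pos_pos add_pos_pos)
        also have "\<dots> \<le> max 1 u / s * exp (- (\<kappa> * \<bar>x\<bar>))"
          using s \<kappa> True by (intro mult_mono divide_right_mono) (auto simp: exp_minus[symmetric] divide_inverse mult_left_le_one_le)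
        finally show ?thesis by (simp add: n)
      next
        case False
        have "1 / D * (1 / (1 + exp x)) \<le> 1 / (a x * s) * 1"
          using D s ap[of x] by (intro mult_mono divide_left_mono) (auto intro!: mult_pos_pos simp: divide_le_eq add_pos_pos)
        also have "\<dots> = u / s * exp (x / \<alpha>)"
          using assms unfolding a_def exp_minus exp_add by (simp add: divide_inverse mult_ac)
        also have "\<dots> \<le> max 1 u / s * exp (- (\<kappa> * \<bar>x\<bar>))"
          using s \<kappa> False mult_right_mono_neg[OF \<kappa>(3), of x]
          by (intro mult_mono divide_right_mono) auto
        finally show ?thesis by (simp add: n)
      qed
      also have "exp (- (\<kappa> * \<bar>x\<bar>)) \<le> 2 * kern (1/2) (0 + \<kappa> * x)"
      proof -
        have "exp (\<kappa> * x) + exp (- (\<kappa> * x)) \<le> 2 * exp (\<kappa> * \<bar>x\<bar>)"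
        proof -
          have "exp (\<kappa> * x) \<le> exp (\<kappa> * \<bar>x\<bar>)" "exp (- (\<kappa> * x)) \<le> exp (\<kappa> * \<bar>x\<bar>)"
            using mult_left_mono[of x "\<bar>x\<bar>" \<kappa>] mult_left_mono[of "- x" "\<bar>x\<bar>" \<kappa>] \<kappa>(1) by auto
          then show ?thesis by linarith
        qed
        then show ?thesis
          by (simp add: kern_def exp_minus[of "\<kappa> * \<bar>x\<bar>"] divide_simps add_pos_pos)
      qed
      finally have "norm (h w x) \<le> max 1 u / s * (2 * kern (1/2) (0 + \<kappa> * x))"
        using s by (simp add: divide_right_mono mult_left_mono)
      also have "\<dots> = 2 * max 1 u / s * kern (1/2) (0 + \<kappa> * x)" by simp
      also have "\<dots> \<le> norm \<dots>" by (simp only: real_norm_def abs_ge_self)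
      finally show "norm (h w x) \<le> norm (2 * max 1 u / s * kern (1/2) (0 + \<kappa> * x))" .
    qed
  qed
  have Imh: "Im (h w x) = - s * (kern \<rho> (ln u + x / \<alpha>) / (1 + exp x))" for x
  proof -
    have D: "(1 + a x * cos (pi * \<rho>))\<^sup>2 + (a x * sin (pi * \<rho>))\<^sup>2 = a x * (2 * cos (pi * \<rho>) + 1 / a x + a x)"
      using sin_cos_squared_add[of "pi * \<rho>"] ap[of x]
      by (simp add: field_simps power2_eq_square) (simp add: power2_eq_square[symmetric] distrib_left[symmetric] algebra_simps)
    have "Im (1 / (1 + complex_of_real (a x) * cis (pi * \<rho>))) = - (a x * s) / (a x * (2 * cos (pi * \<rho>) + 1 / a x + a x))"
      unfolding Im_divide by (simp add: D s_def)
    also have "\<dots> = - s * kern \<rho> (ln u + x / \<alpha>)"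
    proof -
      have "exp (ln u + x / \<alpha>) = 1 / a x" unfolding a_def exp_minus by (simp only: divide_inverse inverse_inverse_eq mult_1_left)
      then have "kern \<rho> (ln u + x / \<alpha>) = 1 / (2 * cos (pi * \<rho>) + 1 / a x + a x)"
        unfolding kern_def a_def[symmetric] by simp
      then show ?thesis using ap[of x] by (simp add: nonzero_divide_mult_cancel_left)
    qed
    finally have *: "Im (1 / (1 + complex_of_real (a x) * cis (pi * \<rho>))) = - s * kern \<rho> (ln u + x / \<alpha>)" .
    have "Im (h w x) = Im (1 / (1 + complex_of_real (a x) * cis (pi * \<rho>))) * (1 / (1 + exp x))"
      unfolding hw by (simp only: times_complex.sel Re_complex_of_real Im_complex_of_real)
    then show ?thesis unfolding * by simp
  qed
  have FI: "Im (F w \<alpha>) = - s * fermi_integral \<alpha> \<rho> u"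
  proof -
    have "Im (F w \<alpha>) = (LINT x|lborel. Im (h w x))"
      unfolding F_def h_def[symmetric] by (rule integral_Im[OF hint, symmetric])
    also have "\<dots> = - s * fermi_integral \<alpha> \<rho> u" unfolding Imh fermi_integral_def by (rule integral_mult_right_zero)
    finally show ?thesis .
  qed
  have "- (complex_of_real pi * \<i> * complex_of_real \<rho>) - complex_of_real (ln u) = cnj w"
    by (simp add: w_def)
  moreover have "F (cnj w) \<alpha> = cnj (F w \<alpha>)"
  proof -
    have "F (cnj w) \<alpha> = (LINT x|lborel. cnj (h w x))"
      unfolding F_def h_def by (intro Bochner_Integration.integral_cong) (simp_all add: exp_cnj)
    also have "\<dots> = cnj (LINT x|lborel. h w x)" by (rule Bochner_Integration.integral_cnj)
    finally show ?thesis by (simp add: F_def h_def)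
  qed
  moreover have "F w \<alpha> - cnj (F w \<alpha>) = 2 * \<i> * complex_of_real (- s * fermi_integral \<alpha> \<rho> u)"
    by (simp add: complex_eq_iff FI)
  ultimately have "1 / (2 * complex_of_real pi * \<i> * complex_of_real u) *
       (F w \<alpha> - F (- (complex_of_real pi * \<i> * complex_of_real \<rho>) - complex_of_real (ln u)) \<alpha>)
     = 1 / (2 * complex_of_real pi * \<i> * complex_of_real u) * (2 * \<i> * complex_of_real (- s * fermi_integral \<alpha> \<rho> u))" by simp
  also have "\<dots> = complex_of_real (- s / (pi * u) * fermi_integral \<alpha> \<rho> u)" using assms by (simp add: field_simps)
  finally show ?thesis by (simp add: w_def s_def)
qed

section \<open>Evaluation of the integral by partial fractions\<close>

lemma Ln_exp_shift_derivative:
  assumes "p \<notin> \<real>\<^sub>\<ge>\<^sub>0"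
  shows "((\<lambda>x. Ln (of_real (exp (\<kappa> * x)) - p)) has_vector_derivative
           of_real \<kappa> * (of_real (exp (\<kappa> * x)) / (of_real (exp (\<kappa> * x)) - p))) (at x)"
proof -
  have ne: "complex_of_real (exp (\<kappa> * x)) - p \<notin> \<real>\<^sub>\<le>\<^sub>0"
  proof
    assume *: "complex_of_real (exp (\<kappa> * x)) - p \<in> \<real>\<^sub>\<le>\<^sub>0"
    have "exp (\<kappa> * x) > 0" by simp
    then have "exp (\<kappa> * x) \<ge> 0" by linarith
    with * have "p \<in> \<real>\<^sub>\<ge>\<^sub>0"
      by (auto simp: complex_nonpos_Reals_iff complex_nonneg_Reals_iff)
         (use exp_gt_zero[of "\<kappa> * x"] in linarith)
    with assms show False by contradiction
  qed
  have "((\<lambda>x. complex_of_real (exp (\<kappa> * x)) - p) has_vector_derivative of_real (\<kappa> * exp (\<kappa> * x))) (at x)"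
    by (auto intro!: derivative_eq_intros has_vector_derivative_of_real)
  moreover have "(Ln has_field_derivative inverse (complex_of_real (exp (\<kappa> * x)) - p)) (at (complex_of_real (exp (\<kappa> * x)) - p))"
    using ne by (rule has_field_derivative_Ln)
  ultimately have "(Ln \<circ> (\<lambda>x. complex_of_real (exp (\<kappa> * x)) - p) has_vector_derivative
      of_real (\<kappa> * exp (\<kappa> * x)) * inverse (complex_of_real (exp (\<kappa> * x)) - p)) (at x)"
    by (rule field_vector_diff_chain_at)
  then show ?thesis by (simp add: o_def divide_inverse mult_ac)
qed

lemma Ln_exp_shift_at_bot:
  assumes "p \<notin> \<real>\<^sub>\<ge>\<^sub>0" "\<kappa> > 0"
  shows "((\<lambda>x. Ln (of_real (exp (\<kappa> * x)) - p)) \<longlongrightarrow> Ln (- p)) at_bot"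
proof -
  have "((\<lambda>x. exp (\<kappa> * x)) \<longlongrightarrow> 0) at_bot"
    using assms by (intro filterlim_compose[OF exp_at_bot] filterlim_tendsto_pos_mult_at_bot[OF tendsto_const] filterlim_ident) auto
  then have "((\<lambda>x. complex_of_real (exp (\<kappa> * x)) - p) \<longlongrightarrow> of_real 0 - p) at_bot"
    by (intro tendsto_intros)
  then have "((\<lambda>x. complex_of_real (exp (\<kappa> * x)) - p) \<longlongrightarrow> - p) at_bot" by simp
  moreover have "- p \<notin> \<real>\<^sub>\<le>\<^sub>0" using assms
    by (auto simp: complex_nonpos_Reals_iff complex_nonneg_Reals_iff)
  ultimately show ?thesis by (rule tendsto_Ln)
qed

text \<open>
  Each logarithm grows like \<open>\<kappa> x\<close>; only a difference has a limit. For this reason the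
  partial fractions below are kept in the form \<open>1/(y - p) - 1/(y - q)\<close>.
\<close>

lemma Ln_exp_shift_diff_at_top:
  assumes "\<kappa> > 0"
  shows "((\<lambda>x. Ln (of_real (exp (\<kappa> * x)) - p) - Ln (of_real (exp (\<kappa> * x)) - q)) \<longlongrightarrow> 0) at_top"
proof -
  define r where "r x = exp (- (\<kappa> * x))" for x
  have r: "(r \<longlongrightarrow> 0) at_top" unfolding r_def
    using assms by (intro filterlim_compose[OF exp_at_bot] filterlim_compose[OF filterlim_uminus_at_bot_at_top]
       filterlim_tendsto_pos_mult_at_top[OF tendsto_const] filterlim_ident) auto
  have lim: "((\<lambda>x. 1 - p * complex_of_real (r x)) \<longlongrightarrow> 1) at_top" for p
    using tendsto_diff[OF tendsto_const[of 1] tendsto_mult_right[OF tendsto_of_real[OF r], of p]] by (simp add: mult.commute)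
  have "((\<lambda>x. Ln (1 - p * complex_of_real (r x)) - Ln (1 - q * complex_of_real (r x))) \<longlongrightarrow> Ln 1 - Ln 1) at_top"
    by (intro tendsto_diff tendsto_Ln lim) auto
  moreover have ev: "eventually (\<lambda>x. Ln (of_real (exp (\<kappa> * x)) - p) = of_real (\<kappa> * x) + Ln (1 - p * complex_of_real (r x))) at_top" for p
  proof -
    have "eventually (\<lambda>x. 1 - p * complex_of_real (r x) \<noteq> 0) at_top"
      using tendsto_imp_eventually_ne[OF lim[of p], of 0] by simp
    then show ?thesis
    proof eventually_elim
      case (elim x)
      have "of_real (exp (\<kappa> * x)) - p = of_real (exp (\<kappa> * x)) * (1 - p * complex_of_real (r x))"
        by (simp add: r_def exp_minus field_simps del: of_real_exp)
      then show ?case using elim Ln_times_of_real[of "exp (\<kappa> * x)" "1 - p * complex_of_real (r x)"]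
        by (simp add: Ln_of_real del: of_real_exp)
    qed
  qed
  ultimately show ?thesis
    by (subst tendsto_cong[where g = "\<lambda>x. Ln (1 - p * complex_of_real (r x)) - Ln (1 - q * complex_of_real (r x))"])
       (use eventually_conj[OF ev[of p] ev[of q]] in \<open>auto elim: eventually_mono\<close>)
qed

lemma nonneg_Reals_power: "z \<in> \<real>\<^sub>\<ge>\<^sub>0 \<Longrightarrow> (z::complex) ^ n \<in> \<real>\<^sub>\<ge>\<^sub>0"
  by (induction n) auto

text \<open>
  The numbers \<open>p k\<close> are meant to be the zeros of \<open>y\<^sup>n - a\<close> and \<open>q j\<close> those of \<open>y\<^sup>m + 1\<close>. Expanding both factors of
  the right-hand side separately gives products \<open>1 / ((y - p k) (y - q j))\<close>, and each of
  them splits as \<open>(1/(y - p k) - 1/(y - q j)) / (p k - q j)\<close>. No residues of the full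
  rational function have to be computed.
\<close>

lemma double_partial_fraction:
  fixes p q :: "nat \<Rightarrow> complex"
  assumes "m > 0"
    and Q: "(\<Sum>j<m. q j / (y - q j)) = - of_nat m / (1 + y ^ m)"
    and P: "(\<Sum>k<n. y / (y - p k)) = of_nat n * y ^ n / (y ^ n - a)"
    and ne: "\<And>k. y \<noteq> p k" "\<And>j. y \<noteq> q j" "\<And>k j. p k \<noteq> q j"
  shows "(\<Sum>k<n. \<Sum>j<m. - (q j / (p k - q j)) * (y / (y - p k) - y / (y - q j)))
           = of_nat m * (of_nat n * y ^ n / (y ^ n - a)) / (1 + y ^ m)"
proof -
  have "- (q j / (p k - q j)) * (y / (y - p k) - y / (y - q j)) = y / (y - p k) * - (q j / (y - q j))" for j k
    using ne(1)[of k] ne(2)[of j] ne(3)[of k j] by (simp add: divide_simps) (simp add: algebra_simps)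
  then have "(\<Sum>k<n. \<Sum>j<m. - (q j / (p k - q j)) * (y / (y - p k) - y / (y - q j)))
     = (\<Sum>k<n. \<Sum>j<m. y / (y - p k) * - (q j / (y - q j)))" by simp
  also have "\<dots> = (\<Sum>k<n. y / (y - p k)) * - (\<Sum>j<m. q j / (y - q j))"
    by (simp only: sum_product sum_negf[symmetric])
  also have "\<dots> = of_nat m * (of_nat n * y ^ n / (y ^ n - a)) / (1 + y ^ m)"
    unfolding P Q by simp
  finally show ?thesis .
qed

text \<open>
  The three families of factors have the shape \<open>\<bar>t + cis \<psi>\<bar>\<^sup>2\<close>, with \<open>t\<close> a power of \<open>z\<close>. The
  real part of this quotient is half the logarithmic derivative of such a factor with
  respect to \<open>ln t\<close>; its imaginary part is a multiple of the kernel.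
\<close>

definition cis_quotient :: "real \<Rightarrow> real \<Rightarrow> complex" where
  "cis_quotient t \<psi> = of_real t / (of_real t + cis \<psi>)"

lemma cmod_add_cis: "(cmod (of_real t + cis \<psi>))\<^sup>2 = 1 + 2 * cos \<psi> * t + t\<^sup>2"
proof -
  have "(t + cos \<psi>)\<^sup>2 + (sin \<psi>)\<^sup>2 = 1 + 2 * cos \<psi> * t + t\<^sup>2"
    using sin_cos_squared_add[of \<psi>] by (simp add: power2_eq_square algebra_simps)
  then show ?thesis by (simp add: cmod_power2)
qed

lemma Re_cis_quotient: "Re (cis_quotient t \<psi>) = (cos \<psi> * t + t\<^sup>2) / (1 + 2 * cos \<psi> * t + t\<^sup>2)"
  and Im_cis_quotient: "Im (cis_quotient t \<psi>) = - t * sin \<psi> / (1 + 2 * cos \<psi> * t + t\<^sup>2)"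
  unfolding cis_quotient_def Re_divide Im_divide cmod_power2[symmetric] cmod_add_cis
  by (simp_all add: power2_eq_square algebra_simps)

lemma Im_cis_quotient_kern:
  assumes "t > 0" shows "Im (cis_quotient t (pi * \<rho>)) = - sin (pi * \<rho>) * kern \<rho> (ln t)"
proof -
  have "1 + 2 * cos (pi * \<rho>) * t + t\<^sup>2 = t * (2 * cos (pi * \<rho>) + t + inverse t)"
    using assms by (simp add: power2_eq_square field_simps)
  then show ?thesis using assms by (simp add: Im_cis_quotient kern_def exp_minus)
qed

text \<open>
  With \<open>\<alpha> = m/n\<close> the substitution \<open>y = exp (x/m)\<close> makes the integrand rational in \<open>y\<close>, with
  poles at the zeros \<open>p k\<close> of \<open>u y\<^sup>n + cis (pi \<rho>)\<close>, at their conjugates, and at the zeros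
  \<open>q j\<close> of \<open>y\<^sup>m + 1\<close>. Taking an imaginary part takes care of the conjugates. The
  antiderivative is a sum of logarithms \<open>Ln (y - p) - Ln (y - q)\<close> that vanishes at
  \<open>+ \<infinity>\<close>; its value at \<open>- \<infinity>\<close> involves \<open>Ln (- p)\<close> and \<open>Ln (- q)\<close>, whose arguments give the
  weights \<open>(2 k + 1 - n) / n\<close> and \<open>(2 j + 1 - m) / m\<close> that reappear as exponents in the product
  formula. The condition \<open>u \<noteq> 1\<close> keeps the two families of poles on different circles.
\<close>

lemma fermi_integral_formula:
  fixes m n :: nat
  assumes m: "m > 0" and n: "n > 0" and \<rho>: "0 < \<rho>" "\<rho> < 1" and u: "u > 0" "u \<noteq> 1"
  defines "\<alpha> \<equiv> real m / real n"
  shows "fermi_integral \<alpha> \<rho> u = real m / (real n * sin (pi * \<rho>)) *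
     ((\<Sum>k<n. pi * (\<rho> + 2 * real k + 1 - real n) / real n * Re (cis_quotient (u powr \<alpha>) (pi * \<alpha> * (\<rho> + 2 * real k + 1)))
             - ln u / real n * Im (cis_quotient (u powr \<alpha>) (pi * \<alpha> * (\<rho> + 2 * real k + 1))))
      - real n / real m * (\<Sum>j<m. pi * (2 * real j + 1 - real m) / real m * Re (cis_quotient u (pi * \<rho> - pi * (2 * real j + 1) / \<alpha>))))"
proof -
  define s where "s = sin (pi * \<rho>)"
  have s: "s > 0" using sin_pi_pos[OF \<rho>] by (simp add: s_def)
  have \<alpha>: "\<alpha> > 0" using m n by (simp add: \<alpha>_def)
  define R where "R = u powr (- 1 / real n)"
  have R: "R > 0" "R \<noteq> 1" using u n by (auto simp: R_def powr_eq_one_iff_gen)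
  define a where "a = - cis (pi * \<rho>) / of_real u"
  define p where "p k = of_real R * cis (pi * (\<rho> + 1) / real n) * cis (2 * pi / real n) ^ k" for k
  define q where "q j = cis (pi / real m) * cis (2 * pi / real m) ^ j" for j
  have p_alt: "p k = of_real R * cis (pi * (\<rho> + 2 * real k + 1) / real n)" for k
    by (simp add: p_def Complex.DeMoivre mult.assoc cis_mult add_divide_distrib[symmetric]) (simp add: algebra_simps)
  have q_alt: "q j = cis (pi * (2 * real j + 1) / real m)" for j
    by (simp add: q_def Complex.DeMoivre cis_mult add_divide_distrib[symmetric]) (simp add: algebra_simps)
  have Rn: "R ^ n = 1 / u" and Rm: "R ^ m = 1 / u powr \<alpha>"
    unfolding powr_realpow[OF R(1), symmetric] unfolding R_def \<alpha>_def powr_powr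
    using u n by (simp_all add: powr_minus_divide)
  have pn: "p k ^ n = a" for k
  proof -
    have "p k ^ n = of_real (R ^ n) * cis (real n * (pi * (\<rho> + 2 * real k + 1) / real n))"
      unfolding p_alt power_mult_distrib Complex.DeMoivre by simp
    also have "real n * (pi * (\<rho> + 2 * real k + 1) / real n) = pi * \<rho> + pi + 2 * pi * real k"
      using n by (simp add: field_simps)
    also have "cis \<dots> = - cis (pi * \<rho>)"
      by (simp add: cis_mult[symmetric] del: cis_mult)
    finally show ?thesis by (simp add: Rn a_def)
  qed
  have qm: "q j ^ m = - 1" for j
  proof -
    have "q j ^ m = cis (real m * (pi * (2 * real j + 1) / real m))"
      unfolding q_alt Complex.DeMoivre ..
    also have "real m * (pi * (2 * real j + 1) / real m) = pi + 2 * pi * real j"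
      using m by (simp add: field_simps)
    also have "cis \<dots> = - 1" by (simp add: cis_mult[symmetric] del: cis_mult)
    finally show ?thesis .
  qed
  have cp: "cmod (p k) = R" and cq: "cmod (q k) = 1" for k
    using R by (simp_all add: p_alt q_alt norm_mult)
  have pq: "p k \<noteq> q j" for k j using cp[of k] cq[of j] R by metis
  have Ima: "Im a < 0" using s u by (simp add: a_def s_def)
  have p_nn: "p k \<notin> \<real>\<^sub>\<ge>\<^sub>0" for k
    using nonneg_Reals_power[of "p k" n] Ima by (auto simp: pn complex_nonneg_Reals_iff)
  have q_nn: "q j \<notin> \<real>\<^sub>\<ge>\<^sub>0" for j
    using nonneg_Reals_power[of "q j" m] by (auto simp: qm complex_nonneg_Reals_iff)
  have Q: "(\<Sum>j<m. q j / (y - q j)) = - of_nat m / (1 + y ^ m)" if y: "y ^ m \<noteq> - 1" for y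
  proof -
    have "y \<noteq> q j" for j using qm[of j] y by metis
    then have "q j / (y - q j) = y / (y - q j) - 1" for j by (simp add: divide_simps)
    then have "(\<Sum>j<m. q j / (y - q j)) = (\<Sum>j<m. y / (y - q j)) - of_nat m"
      by (simp add: sum_subtractf)
    also have "(\<Sum>j<m. y / (y - q j)) = of_nat m * y ^ m / (y ^ m - q 0 ^ m)"
      using sum_inverse_diff_roots[OF m, of "q 0" y] y qm[of 0] by (simp add: q_def)
    also have "\<dots> - of_nat m = - of_nat m / (1 + y ^ m)"
    proof -
      have "1 + y ^ m \<noteq> 0" using y by (simp add: add_eq_0_iff)
      then show ?thesis by (simp add: qm divide_simps add.commute) (simp add: algebra_simps)
    qed
    finally show ?thesis .
  qed
  have P: "(\<Sum>k<n. y / (y - p k)) = of_nat n * y ^ n / (y ^ n - a)" if "y ^ n \<noteq> a" for y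
    using sum_inverse_diff_roots[OF n, of "p 0" y] that pn[of 0] R by (simp add: p_def)
  \<comment> \<open>\<open>S\<close> is linear in \<open>g\<close> and is applied to \<open>y / (y - r)\<close>, to the logarithms \<open>Ln (y - r)\<close>
      that integrate it, and to their boundary values \<open>Ln (- r)\<close>.\<close>
  define S where "S g = (\<Sum>k<n. \<Sum>j<m. - (q j / (p k - q j)) * (g (p k) - g (q j)))" for g :: "complex \<Rightarrow> complex"
  define T where "T x = Im (S (\<lambda>r. Ln (of_real (exp (1 / real m * x)) - r)))" for x :: real
  define f where "f x = kern \<rho> (ln u + x / \<alpha>) / (1 + exp x)" for x
  have dT: "(T has_field_derivative - (real n * s) * f x) (at x)" for x
  proof -
    define y where "y = complex_of_real (exp (1 / real m * x))"
    have ym: "y ^ m = of_real (exp x)" and yn: "y ^ n = of_real (exp (x / \<alpha>))"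
      using m n by (simp_all add: y_def \<alpha>_def exp_of_nat_mult[symmetric] flip: of_real_power)
    have d: "((\<lambda>x. S (\<lambda>r. Ln (of_real (exp (1 / real m * x)) - r))) has_vector_derivative
       S (\<lambda>r. of_real (1 / real m) * (y / (y - r)))) (at x)"
      unfolding S_def y_def
      by (intro has_vector_derivative_sum has_vector_derivative_mult_right has_vector_derivative_diff
            Ln_exp_shift_derivative p_nn q_nn)
    have yreal: "y \<in> \<real>\<^sub>\<ge>\<^sub>0" by (simp add: y_def complex_nonneg_Reals_iff)
    have "S (\<lambda>r. of_real (1 / real m) * (y / (y - r))) = of_real (1 / real m) * S (\<lambda>r. y / (y - r))"
      unfolding S_def sum_distrib_left by (simp only: mult_ac right_diff_distrib)
    also have "S (\<lambda>r. y / (y - r)) = of_nat m * (of_nat n * y ^ n / (y ^ n - a)) / (1 + y ^ m)"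
      unfolding S_def
    proof (rule double_partial_fraction[OF m Q P _ _ pq])
      show "y ^ m \<noteq> - 1"
      proof
        assume "y ^ m = - 1"
        then have "Re (y ^ m) = -1" by simp
        then have "exp x = -1" unfolding ym by (simp only: Re_complex_of_real)
        then show False using exp_gt_zero[of x] by linarith
      qed
      show "y ^ n \<noteq> a" using Ima unfolding yn by (metis Im_complex_of_real less_irrefl)
      show "y \<noteq> p k" "y \<noteq> q k" for k using yreal p_nn[of k] q_nn[of k] by auto
    qed
    also have "of_nat n * y ^ n / (y ^ n - a) = of_nat n * cis_quotient (u * exp (x / \<alpha>)) (pi * \<rho>)"
      unfolding yn cis_quotient_def a_def using u by (simp add: divide_simps mult_ac)
    finally have SV: "S (\<lambda>r. of_real (1 / real m) * (y / (y - r)))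
        = of_real (real n / (1 + exp x)) * cis_quotient (u * exp (x / \<alpha>)) (pi * \<rho>)"
      using m by (simp add: ym)
    have "Im (S (\<lambda>r. of_real (1 / real m) * (y / (y - r)))) = real n / (1 + exp x) * Im (cis_quotient (u * exp (x / \<alpha>)) (pi * \<rho>))"
      unfolding SV by (simp only: times_complex.sel Re_complex_of_real Im_complex_of_real)
    also have "\<dots> = - (real n * s) * f x"
      using u by (simp add: Im_cis_quotient_kern f_def s_def ln_mult)
    finally have "Im (S (\<lambda>r. of_real (1 / real m) * (y / (y - r)))) = - (real n * s) * f x" .
    then show ?thesis
      using bounded_linear.has_vector_derivative[OF bounded_linear_Im d]
      unfolding T_def has_real_derivative_iff_has_vector_derivative by simp
  qed
  have c: "1 / real m > 0" using m by simp
  have Ttop: "(T \<longlongrightarrow> 0) at_top"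
  proof -
    have "(T \<longlongrightarrow> Im (\<Sum>k<n. \<Sum>j<m. - (q j / (p k - q j)) * 0)) at_top"
      unfolding T_def S_def
      by (intro tendsto_Im tendsto_sum tendsto_mult tendsto_const Ln_exp_shift_diff_at_top c)
    then show ?thesis by simp
  qed
  have Tbot: "(T \<longlongrightarrow> Im (S (\<lambda>r. Ln (- r)))) at_bot"
    unfolding T_def S_def
    by (intro tendsto_Im tendsto_sum tendsto_mult tendsto_const tendsto_diff Ln_exp_shift_at_bot c p_nn q_nn)
  have f: "isCont f x" "0 \<le> f x" for x
  proof -
    have "isCont (kern \<rho>) y" for y
      using continuous_kern[OF \<rho>] by (simp add: continuous_on_eq_continuous_at)
    moreover have "isCont (\<lambda>x. ln u + x / \<alpha>) x" using \<alpha> by (intro continuous_intros) auto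
    ultimately have "isCont (\<lambda>x. kern \<rho> (ln u + x / \<alpha>)) x" by (rule isCont_o2[rotated])
    moreover have "1 + exp x \<noteq> 0" using exp_gt_zero[of x] by linarith
    ultimately show "isCont f x" unfolding f_def by (intro continuous_divide continuous_intros)
    show "0 \<le> f x" using kern_pos[OF \<rho>] by (simp add: f_def less_imp_le add_pos_pos)
  qed
  have "(LINT x|lborel. f x) = (0 / (- (real n * s))) - (Im (S (\<lambda>r. Ln (- r))) / (- (real n * s)))"
  proof (rule integral_FTC_nonneg_real_line[where G = "\<lambda>x. T x / (- (real n * s))"])
    show "((\<lambda>x. T x / (- (real n * s))) has_field_derivative f x) (at x)" for x
      using DERIV_cdivide[OF dT[of x], of "- (real n * s)"] s n by simp
    have c: "- (real n * s) \<noteq> 0" using s n by simp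
    show "((\<lambda>x. T x / (- (real n * s))) \<longlongrightarrow> Im (S (\<lambda>r. Ln (- r))) / (- (real n * s))) at_bot"
      by (rule tendsto_divide[OF Tbot tendsto_const c])
    show "((\<lambda>x. T x / (- (real n * s))) \<longlongrightarrow> 0 / (- (real n * s))) at_top"
      by (rule tendsto_divide[OF Ttop tendsto_const c])
  qed (rule f)+
  then have J1: "fermi_integral \<alpha> \<rho> u = Im (S (\<lambda>r. Ln (- r))) / (real n * s)"
    by (simp add: fermi_integral_def f_def)
  have "S (\<lambda>r. Ln (- r)) = (\<Sum>k<n. \<Sum>j<m. Ln (- p k) * - (q j / (p k - q j)) - Ln (- q j) * (q j / (q j - p k)))"
    unfolding S_def
  proof (intro sum.cong refl)
    fix k j
    have "q j / (q j - p k) = - (q j / (p k - q j))" by (metis minus_diff_eq minus_divide_right)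
    then show "- (q j / (p k - q j)) * (Ln (- p k) - Ln (- q j)) = Ln (- p k) * - (q j / (p k - q j)) - Ln (- q j) * (q j / (q j - p k))"
      by (simp add: algebra_simps)
  qed
  also have "\<dots> = (\<Sum>k<n. \<Sum>j<m. Ln (- p k) * - (q j / (p k - q j))) - (\<Sum>j<m. \<Sum>k<n. Ln (- q j) * (q j / (q j - p k)))"
    by (subst sum.swap[of _ "{..<n}" "{..<m}"]) (simp only: sum_subtractf sum.swap[of _ "{..<m}" "{..<n}"])
  also have "\<dots> = (\<Sum>k<n. Ln (- p k) * - (\<Sum>j<m. q j / (p k - q j)))
        - (\<Sum>j<m. Ln (- q j) * (\<Sum>k<n. q j / (q j - p k)))"
    by (simp only: sum_distrib_left sum_negf[symmetric])
  also have "\<dots> = (\<Sum>k<n. Ln (- p k) * (of_nat m * (1 / (1 + p k ^ m))))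
       - (\<Sum>j<m. Ln (- q j) * (of_nat n * (q j ^ n / (q j ^ n - a))))"
  proof -
    have "p k ^ m \<noteq> - 1" for k
    proof
      assume "p k ^ m = - 1"
      then have "R ^ m = 1" using cp[of k] by (metis norm_minus_cancel norm_one norm_power)
      then show False using R m power_eq_iff_eq_base[of m R 1] by simp
    qed
    moreover have "q j ^ n \<noteq> a" for j
    proof
      assume *: "q j ^ n = a"
      have "cmod a = 1 / u" using u by (simp add: a_def norm_divide)
      moreover have "cmod (q j ^ n) = 1" by (simp add: norm_power cq)
      ultimately show False using * u by simp
    qed
    ultimately show ?thesis by (simp add: Q P)
  qed
  finally have S1: "S (\<lambda>r. Ln (- r)) = (\<Sum>k<n. Ln (- p k) * (of_nat m * (1 / (1 + p k ^ m))))
       - (\<Sum>j<m. Ln (- q j) * (of_nat n * (q j ^ n / (q j ^ n - a))))" .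
  have Lp: "Ln (- p k) = Complex (- ln u / real n) (pi * (\<rho> + 2 * real k + 1 - real n) / real n)" if "k < n" for k
  proof -
    \<comment> \<open>The argument of \<open>p k\<close> lies in \<open>(0, 2 pi)\<close>, so subtracting \<open>pi\<close> gives the principal
        argument of \<open>- p k\<close>.\<close>
    define t where "t = pi * (\<rho> + 2 * real k + 1 - real n) / real n"
    have t_eq: "pi * (\<rho> + 2 * real k + 1) / real n = t + pi" using n by (simp add: t_def field_simps)
    have k1: "real k + 1 \<le> real n" using that by simp
    have "pi * (- real n) < pi * (\<rho> + 2 * real k + 1 - real n)" "pi * (\<rho> + 2 * real k + 1 - real n) < pi * real n"
      using k1 \<rho> by (intro mult_strict_left_mono; simp)+
    then have "- pi < t" "t \<le> pi" using n unfolding t_def by (simp_all add: field_simps)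
    then have "Ln (cis t) = t * \<i>" by (intro Ln_cis) auto
    moreover have "- p k = of_real R * cis t"
      unfolding p_alt t_eq by (simp add: cis_mult[symmetric])
    ultimately have "Ln (- p k) = of_real (ln R) + t * \<i>"
      using Ln_times_of_real[OF R(1), of "cis t"] by (simp add: Ln_of_real R(1))
    moreover have "ln R = - ln u / real n" using u by (simp add: R_def ln_powr)
    ultimately show ?thesis by (simp add: t_def complex_eq_iff)
  qed
  have Lq: "Ln (- q j) = Complex 0 (pi * (2 * real j + 1 - real m) / real m)" if "j < m" for j
  proof -
    define t where "t = pi * (2 * real j + 1 - real m) / real m"
    have t_eq: "pi * (2 * real j + 1) / real m = t + pi" using m by (simp add: t_def field_simps)
    have "real j + 1 \<le> real m" using that by simp
    then have "pi * (- real m) < pi * (2 * real j + 1 - real m)" "pi * (2 * real j + 1 - real m) < pi * real m"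
      by (intro mult_strict_left_mono; simp)+
    then have "- pi < t" "t \<le> pi" using m unfolding t_def by (simp_all add: field_simps)
    then have "Ln (cis t) = t * \<i>" by (intro Ln_cis) auto
    moreover have "- q j = cis t" unfolding q_alt t_eq by (simp add: cis_mult[symmetric])
    ultimately have "Ln (- q j) = t * \<i>" by simp
    then show ?thesis by (simp add: t_def complex_eq_iff)
  qed
  have Vp: "1 / (1 + p k ^ m) = cis_quotient (u powr \<alpha>) (pi * \<alpha> * (\<rho> + 2 * real k + 1))" for k
  proof -
    have "p k ^ m = of_real (R ^ m) * cis (pi * \<alpha> * (\<rho> + 2 * real k + 1))"
      unfolding p_alt power_mult_distrib Complex.DeMoivre by (simp add: \<alpha>_def mult_ac)
    also have "1 + \<dots> = (of_real (u powr \<alpha>) + cis (pi * \<alpha> * (\<rho> + 2 * real k + 1))) / of_real (u powr \<alpha>)"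
      unfolding Rm using u by (simp add: add_divide_distrib)
    finally show ?thesis by (simp add: cis_quotient_def)
  qed
  have Vq: "q j ^ n / (q j ^ n - a) = cis_quotient u (pi * \<rho> - pi * (2 * real j + 1) / \<alpha>)" for j
  proof -
    have "q j ^ n = cis (pi * (2 * real j + 1) / \<alpha>)"
      unfolding q_alt Complex.DeMoivre by (simp add: \<alpha>_def mult_ac)
    moreover have "cis \<eta> / (cis \<eta> - a) = cis_quotient u (pi * \<rho> - \<eta>)" for \<eta>
    proof -
      have "of_real u + cis (pi * \<rho> - \<eta>) = of_real u * (cis \<eta> - a) / cis \<eta>"
        using u by (simp add: a_def field_simps cis_mult)
      then show ?thesis using u by (simp add: cis_quotient_def)
    qed
    ultimately show ?thesis by simp
  qed
  have "Im (S (\<lambda>r. Ln (- r))) = 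
       (\<Sum>k<n. real m * (pi * (\<rho> + 2 * real k + 1 - real n) / real n * Re (cis_quotient (u powr \<alpha>) (pi * \<alpha> * (\<rho> + 2 * real k + 1)))
             - ln u / real n * Im (cis_quotient (u powr \<alpha>) (pi * \<alpha> * (\<rho> + 2 * real k + 1)))))
      - (\<Sum>j<m. real n * (pi * (2 * real j + 1 - real m) / real m * Re (cis_quotient u (pi * \<rho> - pi * (2 * real j + 1) / \<alpha>))))"
    unfolding S1 minus_complex.sel Im_sum
    by (intro arg_cong2[where f = "(-)"] sum.cong refl) (simp_all add: Lp Lq Vp Vq algebra_simps)
  moreover have "(M * A - N * B) / (N * s) = M / (N * s) * (A - N / M * B)" if "M > 0" "N > 0" for M N A B
    using that s by (simp add: field_simps)
  ultimately show ?thesis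
    unfolding J1 s_def[symmetric] sum_distrib_left[symmetric] using m n by simp
qed

section \<open>The logarithm of the product formula\<close>

text \<open>
  The continuous branch with values in \<open>(0, pi)\<close>. Since the Clausen terms have period
  \<open>pi\<close> in the angle, any other branch gives the same value.
\<close>

definition arccot :: "real \<Rightarrow> real" where "arccot x = pi / 2 - arctan x"

lemma cot_inverse_arccot: "cot_inverse arccot"
proof -
  have "cot (arccot x) = x" for x
    using tan_arctan[of x] by (simp add: arccot_def cot_def tan_def sin_diff cos_diff)
  moreover have "sin (arccot x) \<noteq> 0" for x by (simp add: arccot_def sin_diff)
  ultimately show ?thesis by (simp add: cot_inverse_def)
qed

lemma sin_pi_times_eq_0_iff: "sin (pi * real m * \<rho>) = 0 \<longleftrightarrow> real m * \<rho> \<in> \<int>"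
  by (metis mult.commute mult.left_commute sin_times_pi_eq_0)

text \<open>
  This form of the equation that defines \<open>theta\<close> explains why the Clausen terms simplify
  under differentiation: \<open>\<bar>sin (\<theta> - \<beta>) / sin \<theta>\<bar> = z\<^sup>m\<close>.
\<close>

lemma cot_shift_iff:
  fixes x \<beta> c :: real
  assumes "sin x \<noteq> 0" "sin \<beta> \<noteq> 0"
  shows "cot x = cot \<beta> + c / sin \<beta> \<longleftrightarrow> sin (x - \<beta>) = - c * sin x"
proof -
  have "sin (x - \<beta>) = sin x * (cos \<beta> - cot x * sin \<beta>)"
    using assms by (simp add: sin_diff cot_def field_simps)
  also have "\<dots> = - c * sin x \<longleftrightarrow> cos \<beta> - cot x * sin \<beta> = - c"
    using assms(1) by (metis mult.commute mult_cancel_right)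
  also have "\<dots> \<longleftrightarrow> cot x = cot \<beta> + c / sin \<beta>" 
  proof -
    have "cot \<beta> = cos \<beta> / sin \<beta>" by (simp add: cot_def)
    then show ?thesis using assms(2) by (auto simp: field_simps)
  qed
  finally show ?thesis by blast
qed

lemma theta_arccot_sin:
  assumes "real m * \<rho> \<notin> \<int>"
  shows "sin (theta arccot m n \<rho> z) \<noteq> 0"
    "sin (theta arccot m n \<rho> z - pi * real m * \<rho>) = - ((- 1) ^ (m * n) * z ^ m) * sin (theta arccot m n \<rho> z)"
proof -
  have s: "sin (pi * real m * \<rho>) \<noteq> 0"
    using assms by (simp only: sin_pi_times_eq_0_iff not_False_eq_True)
  show 1: "sin (theta arccot m n \<rho> z) \<noteq> 0"
    using assms cot_inverse_arccot by (auto simp: cot_inverse_def theta_def)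
  show "sin (theta arccot m n \<rho> z - pi * real m * \<rho>) = - ((- 1) ^ (m * n) * z ^ m) * sin (theta arccot m n \<rho> z)"
    using assms cot_inverse_arccot
    by (subst cot_shift_iff[OF 1 s, symmetric]) (auto simp: cot_inverse_def theta_def)
qed

definition clausen_part :: "(real \<Rightarrow> real) \<Rightarrow> nat \<Rightarrow> nat \<Rightarrow> real \<Rightarrow> real \<Rightarrow> real" where
  "clausen_part acot m n \<rho> z = Cl2 (2 * theta acot m n \<rho> z) - Cl2 (2 * pi * real m * \<rho>)
     - Cl2 (2 * theta acot m n \<rho> z - 2 * pi * real m * \<rho>)"

lemma sin_diff_0_imp_Cl2_eq:
  assumes "sin (a - b) = 0" shows "Cl2 (2 * a - c) = Cl2 (2 * b - c)"
proof -
  obtain i :: int where "a - b = of_int i * pi" using assms by (auto simp: sin_zero_iff_int2)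
  then have "2 * a - c = (2 * b - c) + 2 * pi * of_int i" by (simp add: algebra_simps)
  then show ?thesis by (simp only: Cl2_periodic[OF Ints_of_int])
qed

lemma cot_eq_imp_sin_diff_0:
  fixes a b :: real
  assumes "sin a \<noteq> 0" "sin b \<noteq> 0" "cot a = cot b" shows "sin (a - b) = 0"
  using assms by (simp add: cot_def sin_diff field_simps)

lemma clausen_part_branch:
  assumes "cot_inverse acot" "cot_inverse acot'"
  shows "clausen_part acot m n \<rho> z = clausen_part acot' m n \<rho> z"
proof (cases "real m * \<rho> \<in> \<int>")
  case True then show ?thesis by (simp add: clausen_part_def theta_def)
next
  case False
  let ?X = "cot (pi * real m * \<rho>) + (- 1) ^ (m * n) * z ^ m / sin (pi * real m * \<rho>)"
  have "sin (acot ?X - acot' ?X) = 0"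
    using assms by (intro cot_eq_imp_sin_diff_0) (auto simp: cot_inverse_def)
  from sin_diff_0_imp_Cl2_eq[OF this] sin_diff_0_imp_Cl2_eq[OF this, of 0] False show ?thesis
    by (simp add: clausen_part_def theta_def)
qed

lemma quadratic_pos:
  fixes c t :: real
  assumes "\<bar>c\<bar> \<le> 1" "t > 0" "t \<noteq> 1"
  shows "1 + 2 * c * t + t\<^sup>2 > 0"
proof -
  have "(1 - t)\<^sup>2 > 0" using assms by simp
  moreover have "- t \<le> c * t" using assms mult_right_mono[of "-1" c t] by auto
  ultimately show ?thesis by (simp add: power2_eq_square algebra_simps)
qed

lemma factor0_quadratic:
  "factor0 m n \<rho> z = 1 + 2 * ((- 1) ^ (m * n) * cos (pi * real m * \<rho>)) * z ^ m + (z ^ m)\<^sup>2"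
  by (simp add: factor0_def power_mult[symmetric] mult.commute)

lemma factor1_quadratic:
  "factor1 \<alpha> \<rho> k z = 1 + 2 * cos (pi * \<alpha> * (\<rho> + 2 * real k + 1)) * (z powr \<alpha>) + (z powr \<alpha>)\<^sup>2"
  by (simp add: factor1_def power2_eq_square powr_add[symmetric])

lemma abs_sign_cos: "\<bar>(- 1) ^ k * cos x\<bar> \<le> (1::real)"
  by (simp add: abs_mult power_abs)

lemma factors_pos:
  assumes "z > 0" "z \<noteq> 1" "m > 0" "\<alpha> > 0"
  shows "factor0 m n \<rho> z > 0" "factor1 \<alpha> \<rho> k z > 0" "factor2 \<alpha> \<rho> j z > 0"
  unfolding factor0_quadratic factor1_quadratic factor2_def
  using assms power_eq_iff_eq_base[of m z 1]
  by (auto intro!: quadratic_pos abs_sign_cos simp: powr_eq_one_iff_gen)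

definition log_rhs :: "nat \<Rightarrow> nat \<Rightarrow> real \<Rightarrow> real \<Rightarrow> real \<Rightarrow> real" where
  "log_rhs m n \<alpha> \<rho> z = clausen_part arccot m n \<rho> z / (2 * pi * real m * real n)
     - \<rho> / (2 * real n) * ln (factor0 m n \<rho> z)
     + (\<Sum>k<n. (real n - 2 * real k - 1) / (2 * real n) * ln (factor1 \<alpha> \<rho> k z))
     + (\<Sum>j<m. (real m - 2 * real j - 1) / (2 * real m) * ln (factor2 \<alpha> \<rho> j z))"

lemma phi_rhs_eq_exp_log_rhs:
  assumes "cot_inverse acot" "z > 0" "\<not> some_factor_vanishes m n \<alpha> \<rho> z"
  shows "phi_rhs acot m n \<alpha> \<rho> z = exp (log_rhs m n \<alpha> \<rho> z)"
proof -
  have ne: "factor0 m n \<rho> z \<noteq> 0" "\<And>k. k < n \<Longrightarrow> factor1 \<alpha> \<rho> k z \<noteq> 0" "\<And>j. j < m \<Longrightarrow> factor2 \<alpha> \<rho> j z \<noteq> 0"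
    using assms(3) by (auto simp: some_factor_vanishes_def)
  have "phi_rhs acot m n \<alpha> \<rho> z = exp (clausen_part acot m n \<rho> z / (2 * pi * real m * real n))
      * exp (- (\<rho> / (2 * real n) * ln (factor0 m n \<rho> z)))
      * (\<Prod>k<n. exp ((real n - 2 * real k - 1) / (2 * real n) * ln (factor1 \<alpha> \<rho> k z)))
      * (\<Prod>j<m. exp ((real m - 2 * real j - 1) / (2 * real m) * ln (factor2 \<alpha> \<rho> j z)))"
    unfolding phi_rhs_def Let_def clausen_part_def
    by (intro arg_cong2[where f = "(*)"] prod.cong refl) (use ne in \<open>simp_all add: powr_def\<close>)
  also have "\<dots> = exp (log_rhs m n \<alpha> \<rho> z)"
    unfolding log_rhs_def clausen_part_branch[OF assms(1) cot_inverse_arccot]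
    by (simp only: diff_conv_add_uminus exp_add exp_sum finite_lessThan)
  finally show ?thesis .
qed

text \<open>
  By \<open>Cl2_deriv\<close> the derivative is \<open>2 \<theta>' ln \<bar>sin (\<theta> - \<beta>) / sin \<theta>\<bar>\<close> with \<open>\<beta> = pi m \<rho>\<close>, and the
  quotient of sines is \<open>z\<^sup>m\<close> up to sign. The identity \<open>(1 + cot\<^sup>2 \<theta>) sin\<^sup>2 \<beta> = factor0\<close>
  evaluates \<open>\<theta>'\<close>.
\<close>

lemma clausen_part_deriv:
  assumes "z > 0" "m > 0" "z \<noteq> 1"
  shows "(clausen_part arccot m n \<rho> has_field_derivative
     - (2 * real m * real m * (- 1) ^ (m * n) * z ^ m * sin (pi * real m * \<rho>) * ln z / (z * factor0 m n \<rho> z))) (at z)"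
proof (cases "real m * \<rho> \<in> \<int>")
  case True
  then have "sin (pi * real m * \<rho>) = 0" by (simp only: sin_pi_times_eq_0_iff)
  moreover have "clausen_part arccot m n \<rho> = (\<lambda>z. Cl2 0 - Cl2 (2 * pi * real m * \<rho>) - Cl2 (0 - 2 * pi * real m * \<rho>))"
    using True by (intro ext) (simp add: clausen_part_def theta_def)
  ultimately show ?thesis by simp
next
  case False
  define \<beta> where "\<beta> = pi * real m * \<rho>"
  define \<epsilon> :: real where "\<epsilon> = (- 1) ^ (m * n)"
  have \<epsilon>: "\<epsilon> * \<epsilon> = 1" "\<bar>\<epsilon>\<bar> = 1" by (simp_all add: \<epsilon>_def power_mult_distrib[symmetric] power_abs)
  have s\<beta>: "sin \<beta> \<noteq> 0"
    using False unfolding \<beta>_def by (simp only: sin_pi_times_eq_0_iff not_False_eq_True)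
  define X where "X z = cot \<beta> + \<epsilon> * z ^ m / sin \<beta>" for z
  define \<theta> where "\<theta> z = arccot (X z)" for z
  define f0 where "f0 = factor0 m n \<rho> z"
  have f0: "f0 > 0" unfolding f0_def using assms by (intro factors_pos(1)[where \<alpha> = 1]) auto
  have X2: "1 + (X z)\<^sup>2 = f0 / (sin \<beta>)\<^sup>2"
  proof -
    have "(1 + (X z)\<^sup>2) * (sin \<beta>)\<^sup>2 = (sin \<beta>)\<^sup>2 + (cos \<beta> + \<epsilon> * z ^ m)\<^sup>2"
      using s\<beta> by (simp add: X_def cot_def power2_eq_square field_simps)
    also have "\<dots> = (sin \<beta>)\<^sup>2 + (cos \<beta>)\<^sup>2 + 2 * (\<epsilon> * cos \<beta>) * z ^ m + (\<epsilon> * \<epsilon>) * (z ^ m)\<^sup>2"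
      by (simp add: power2_eq_square algebra_simps)
    also have "\<dots> = f0" by (simp add: \<epsilon>(1) f0_def factor0_quadratic \<epsilon>_def \<beta>_def)
    finally show ?thesis using s\<beta> by (simp add: field_simps)
  qed
  define \<theta>' where "\<theta>' = - (\<epsilon> * (real m * z ^ m) * sin \<beta> / (z * f0))"
  have zm: "real m * z ^ (m - Suc 0) = real m * z ^ m / z"
    using assms by (cases m) auto
  have d\<theta>: "(\<theta> has_field_derivative \<theta>') (at z)"
  proof -
    have "(X has_field_derivative 0 + \<epsilon> * (real m * z ^ (m - Suc 0)) / sin \<beta>) (at z)"
      unfolding X_def by (intro DERIV_add DERIV_const DERIV_cdivide DERIV_cmult DERIV_pow)
    then have "(X has_field_derivative \<epsilon> * (real m * z ^ m / z) / sin \<beta>) (at z)"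
      unfolding zm by simp
    then have "(\<theta> has_field_derivative - (inverse (1 + (X z)\<^sup>2) * (\<epsilon> * (real m * z ^ m / z) / sin \<beta>))) (at z)"
      unfolding \<theta>_def arccot_def using DERIV_chain2[OF DERIV_arctan]
      by (auto intro!: derivative_eq_intros)
    also have "- (inverse (1 + (X z)\<^sup>2) * (\<epsilon> * (real m * z ^ m / z) / sin \<beta>)) = \<theta>'"
      unfolding X2 \<theta>'_def using s\<beta> f0 assms by (simp add: field_simps power2_eq_square)
    finally show ?thesis .
  qed
  have "theta arccot m n \<rho> z = \<theta> z"
    using False by (simp add: theta_def \<theta>_def X_def \<beta>_def \<epsilon>_def)
  then have sin\<theta>: "sin (\<theta> z) \<noteq> 0" and "sin (\<theta> z - \<beta>) = - (\<epsilon> * z ^ m) * sin (\<theta> z)"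
    using theta_arccot_sin[OF False, of n z] by (simp_all add: \<beta>_def \<epsilon>_def)
  then have "\<bar>sin (\<theta> z - \<beta>)\<bar> = \<bar>sin (\<theta> z)\<bar> * z ^ m"
    using \<epsilon> assms by (simp add: abs_mult)
  moreover have "\<bar>sin (\<theta> z)\<bar> > 0" using sin\<theta> by simp
  ultimately have ln\<theta>: "ln (2 * \<bar>sin (\<theta> z - \<beta>)\<bar>) - ln (2 * \<bar>sin (\<theta> z)\<bar>) = real m * ln z"
    and sin\<theta>\<beta>: "sin (\<theta> z - \<beta>) \<noteq> 0"
    using assms by (auto simp: ln_mult ln_realpow)
  have "((\<lambda>z. Cl2 (2 * \<theta> z)) has_field_derivative - ln (2 * \<bar>sin (2 * \<theta> z / 2)\<bar>) * (2 * \<theta>')) (at z)"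
    using sin\<theta> by (intro DERIV_chain2[OF Cl2_deriv]) (auto intro!: derivative_eq_intros d\<theta>)
  moreover have "((\<lambda>z. Cl2 (2 * \<theta> z - 2 * \<beta>)) has_field_derivative - ln (2 * \<bar>sin ((2 * \<theta> z - 2 * \<beta>) / 2)\<bar>) * (2 * \<theta>')) (at z)"
    using sin\<theta>\<beta> by (intro DERIV_chain2[OF Cl2_deriv]) (auto intro!: derivative_eq_intros d\<theta> simp: diff_divide_distrib)
  ultimately have "((\<lambda>z. Cl2 (2 * \<theta> z) - Cl2 (2 * \<beta>) - Cl2 (2 * \<theta> z - 2 * \<beta>)) has_field_derivative
     - ln (2 * \<bar>sin (\<theta> z)\<bar>) * (2 * \<theta>') - 0 - - ln (2 * \<bar>sin (\<theta> z - \<beta>)\<bar>) * (2 * \<theta>')) (at z)"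
    by (intro DERIV_diff DERIV_const) (simp_all add: diff_divide_distrib)
  also have "- ln (2 * \<bar>sin (\<theta> z)\<bar>) * (2 * \<theta>') - 0 - - ln (2 * \<bar>sin (\<theta> z - \<beta>)\<bar>) * (2 * \<theta>')
     = 2 * \<theta>' * (ln (2 * \<bar>sin (\<theta> z - \<beta>)\<bar>) - ln (2 * \<bar>sin (\<theta> z)\<bar>))"
    by (simp add: algebra_simps)
  also have "\<dots> = - (2 * real m * real m * \<epsilon> * z ^ m * sin \<beta> * ln z / (z * f0))"
    unfolding ln\<theta> by (simp add: \<theta>'_def)
  finally show ?thesis
    using False unfolding clausen_part_def theta_def \<theta>_def X_def \<beta>_def \<epsilon>_def f0_def
    by (simp add: mult.assoc)
qed

text \<open>
  As \<open>k\<close> runs, the angles advance by \<open>2 pi m / n\<close>, so coprimality makes them a full set of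
  rotated \<open>n\<close>-th roots of unity. The quotients for the angles of \<open>factor1\<close> then add up to
  the quotient for \<open>factor0\<close>; the real part of this identity is the logarithmic derivative of the factorization
  \<open>factor0 = \<Prod>k<n. factor1 k\<close>. The extra angle \<open>pi\<close> for odd \<open>m n\<close> is the sign \<open>(- 1) ^ (m n)\<close>,
  which equals \<open>- (- 1) ^ (m + n)\<close> because \<open>m\<close> and \<open>n\<close> are not both even.
\<close>

lemma sum_cis_quotient_roots:
  fixes m n :: nat
  assumes "m > 0" "n > 0" "coprime m n" "u > 0" "u \<noteq> 1" "\<alpha> = real m / real n"
  shows "(\<Sum>k<n. cis_quotient (u powr \<alpha>) (pi * \<alpha> * (\<rho> + 2 * real k + 1)))
     = of_nat n * cis_quotient (u ^ m) (pi * real m * \<rho> + (if even (m * n) then 0 else pi))"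
proof -
  define x where "x = - cis (pi * \<alpha> * (\<rho> + 1)) / of_real (u powr \<alpha>)"
  define \<omega> where "\<omega> = cis (2 * pi * real m / real n)"
  define e where "e = (if even (m * n) then 0 else pi)"
  have t: "u powr \<alpha> > 0" using assms by simp
  have cis_quotient: "cis_quotient (u powr \<alpha>) (pi * \<alpha> * (\<rho> + 2 * real k + 1)) = 1 / (1 - x * \<omega> ^ k)" for k
  proof -
    have "cis (pi * \<alpha> * (\<rho> + 2 * real k + 1)) = cis (pi * \<alpha> * (\<rho> + 1)) * \<omega> ^ k"
      unfolding \<omega>_def Complex.DeMoivre cis_mult by (simp add: assms algebra_simps add_divide_distrib)
    then have "1 - x * \<omega> ^ k = (of_real (u powr \<alpha>) + cis (pi * \<alpha> * (\<rho> + 2 * real k + 1))) / of_real (u powr \<alpha>)"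
      using t by (simp add: x_def add_divide_distrib)
    then show ?thesis by (simp add: cis_quotient_def)
  qed
  have un: "(u powr \<alpha>) ^ n = u ^ m"
    using assms t by (simp add: powr_realpow[symmetric] powr_powr)
  have xn: "x ^ n = - cis (pi * real m * \<rho> + e) / of_real (u ^ m)"
  proof -
    have "x ^ n = (- 1) ^ n * cis (real n * (pi * \<alpha> * (\<rho> + 1))) / of_real (u ^ m)"
    proof -
      have "x ^ n = (- 1 * cis (pi * \<alpha> * (\<rho> + 1)) / of_real (u powr \<alpha>)) ^ n"
        by (simp add: x_def)
      then show ?thesis
        unfolding power_divide power_mult_distrib Complex.DeMoivre of_real_power[symmetric] un .
    qed
    also have "real n * (pi * \<alpha> * (\<rho> + 1)) = pi * real m * \<rho> + real m * pi"
      using assms by (simp add: field_simps)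
    also have "(- 1) ^ n * cis (pi * real m * \<rho> + real m * pi) = - cis (pi * real m * \<rho> + e)"
    proof -
      have "cis (real m * pi) = (- 1) ^ m" using Complex.DeMoivre[of pi m] by simp
      then have "(- 1) ^ n * cis (pi * real m * \<rho> + real m * pi) = cis (pi * real m * \<rho>) * ((- 1) ^ n * (- 1) ^ m)"
        by (simp only: cis_mult[symmetric] mult_ac)
      also have "(- 1) ^ n * (- 1) ^ m = - cis e"
        using assms(3) by (cases "even m"; cases "even n") (auto simp: e_def)
      also have "cis (pi * real m * \<rho>) * - cis e = - cis (pi * real m * \<rho> + e)"
        by (simp add: cis_mult)
      finally show ?thesis .
    qed
    finally show ?thesis .
  qed
  have "x ^ n \<noteq> 1"
  proof
    assume "x ^ n = 1"
    then have "cmod (x ^ n) = 1" by simp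
    then show False using assms power_eq_iff_eq_base[of m u 1] by (simp add: xn norm_divide norm_power)
  qed
  then have "(\<Sum>k<n. 1 / (1 - x * \<omega> ^ k)) = of_nat n / (1 - x ^ n)"
    unfolding \<omega>_def using assms by (intro sum_inverse_one_minus_roots) auto
  also have "1 - x ^ n = (of_real (u ^ m) + cis (pi * real m * \<rho> + e)) / of_real (u ^ m)"
    unfolding xn using assms by (simp add: add_divide_distrib)
  finally show ?thesis unfolding cis_quotient by (simp add: cis_quotient_def e_def)
qed

lemma ln_quadratic_deriv:
  assumes t: "(t has_field_derivative \<kappa> * t u / u) (at u)" and pos: "1 + 2 * cos \<psi> * t u + (t u)\<^sup>2 > 0"
  shows "((\<lambda>z. ln (1 + 2 * cos \<psi> * t z + (t z)\<^sup>2)) has_field_derivative 2 * \<kappa> / u * Re (cis_quotient (t u) \<psi>)) (at u)"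
proof -
  have "((\<lambda>z. ln (1 + 2 * cos \<psi> * t z + (t z)\<^sup>2)) has_field_derivative
      (1 / (1 + 2 * cos \<psi> * t u + (t u)\<^sup>2)) * (0 + 2 * cos \<psi> * (\<kappa> * t u / u) + of_nat 2 * (\<kappa> * t u / u * t u ^ (2 - Suc 0)))) (at u)"
    by (rule DERIV_chain2[where f = ln and g = "\<lambda>z. 1 + 2 * cos \<psi> * t z + (t z)\<^sup>2", OF DERIV_ln_divide[OF pos]])
       (intro DERIV_add DERIV_const DERIV_cmult DERIV_power t)
  also have "(1 / (1 + 2 * cos \<psi> * t u + (t u)\<^sup>2)) * (0 + 2 * cos \<psi> * (\<kappa> * t u / u) + of_nat 2 * (\<kappa> * t u / u * t u ^ (2 - Suc 0)))
      = 2 * \<kappa> / u * ((cos \<psi> * t u + (t u)\<^sup>2) / (1 + 2 * cos \<psi> * t u + (t u)\<^sup>2))"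
    by (simp add: power2_eq_square divide_inverse algebra_simps)
  finally show ?thesis unfolding Re_cis_quotient .
qed

text \<open>
  Both sides are explicit. In \<open>fermi_integral_formula\<close> the poles \<open>p k\<close> contribute the exponents of
  \<open>factor1\<close>, and in addition a constant multiple of \<open>\<Sum> Re\<close> and of \<open>ln u \<Sum> Im\<close>; by
  \<open>sum_cis_quotient_roots\<close> these are the derivatives of the power of \<open>factor0\<close> and of the Clausen terms.
  The poles \<open>q j\<close> contribute the powers of \<open>factor2\<close>.
\<close>

lemma log_rhs_deriv:
  fixes m n :: nat
  assumes m: "m > 0" and n: "n > 0" and mn: "coprime m n" and \<rho>: "0 < \<rho>" "\<rho> < 1" and u: "u > 0" "u \<noteq> 1"
    and \<alpha>: "\<alpha> = real m / real n"
  shows "(log_rhs m n \<alpha> \<rho> has_field_derivative - sin (pi * \<rho>) / (pi * u) * fermi_integral \<alpha> \<rho> u) (at u)"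
proof -
  define \<psi> where "\<psi> k = pi * \<alpha> * (\<rho> + 2 * real k + 1)" for k
  define \<eta> where "\<eta> j = pi / \<alpha> * (\<alpha> * \<rho> + 2 * real j + 1)" for j
  define \<beta> where "\<beta> = pi * real m * \<rho> + (if even (m * n) then 0 else pi)"
  have \<beta>: "cos \<beta> = (- 1) ^ (m * n) * cos (pi * real m * \<rho>)" "sin \<beta> = (- 1) ^ (m * n) * sin (pi * real m * \<rho>)"
    unfolding \<beta>_def by auto
  have ap: "\<alpha> > 0" using m n \<alpha> by simp
  note pos = factors_pos[OF u m ap]
  have f0: "factor0 m n \<rho> = (\<lambda>z. 1 + 2 * cos \<beta> * z ^ m + (z ^ m)\<^sup>2)"
    by (intro ext) (simp only: factor0_quadratic \<beta>)
  have f1: "factor1 \<alpha> \<rho> k = (\<lambda>z. 1 + 2 * cos (\<psi> k) * (z powr \<alpha>) + (z powr \<alpha>)\<^sup>2)" for k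
    by (intro ext) (simp only: factor1_quadratic \<psi>_def)
  have f2: "factor2 \<alpha> \<rho> j = (\<lambda>z. 1 + 2 * cos (\<eta> j) * z + z\<^sup>2)" for j
    by (intro ext) (simp only: factor2_def \<eta>_def)
  have dm: "((\<lambda>z. z ^ m) has_field_derivative real m * u ^ m / u) (at u)"
  proof -
    have "real m * u ^ (m - Suc 0) = real m * u ^ m / u" using m u by (cases m) auto
    then show ?thesis using DERIV_pow[of m u UNIV] by simp
  qed
  have da: "((\<lambda>z. z powr \<alpha>) has_field_derivative \<alpha> * u powr \<alpha> / u) (at u)"
    using has_real_derivative_powr[OF u(1), of \<alpha>] u by (simp add: powr_diff)
  have d1: "((\<lambda>z. z) has_field_derivative 1 * u / u) (at u)" using u by simp
  have D0: "((\<lambda>z. ln (factor0 m n \<rho> z)) has_field_derivative 2 * real m / u * Re (cis_quotient (u ^ m) \<beta>)) (at u)"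
    unfolding f0 by (rule ln_quadratic_deriv[OF dm]) (use pos(1)[of n \<rho>] in \<open>simp add: f0\<close>)
  have D1: "((\<lambda>z. ln (factor1 \<alpha> \<rho> k z)) has_field_derivative 2 * \<alpha> / u * Re (cis_quotient (u powr \<alpha>) (\<psi> k))) (at u)" for k
    unfolding f1 by (rule ln_quadratic_deriv[OF da]) (use pos(2)[of \<rho> k] in \<open>simp add: f1\<close>)
  have D2: "((\<lambda>z. ln (factor2 \<alpha> \<rho> j z)) has_field_derivative 2 * 1 / u * Re (cis_quotient u (\<eta> j))) (at u)" for j
    unfolding f2 by (rule ln_quadratic_deriv[OF d1]) (use pos(3)[of \<rho> j] in \<open>simp add: f2\<close>)
  have DK: "(clausen_part arccot m n \<rho> has_field_derivative 2 * real m * real m * ln u / u * Im (cis_quotient (u ^ m) \<beta>)) (at u)"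
  proof -
    have "2 * real m * real m * ln u / u * Im (cis_quotient (u ^ m) \<beta>)
       = - (2 * real m * real m * (- 1) ^ (m * n) * u ^ m * sin (pi * real m * \<rho>) * ln u / (u * factor0 m n \<rho> u))"
      unfolding Im_cis_quotient f0 \<beta>(2) by (simp add: mult_ac)
    then show ?thesis using clausen_part_deriv[OF u(1) m u(2)] by simp
  qed
  have "(log_rhs m n \<alpha> \<rho> has_field_derivative
     (2 * real m * real m * ln u / u * Im (cis_quotient (u ^ m) \<beta>)) / (2 * pi * real m * real n)
     - \<rho> / (2 * real n) * (2 * real m / u * Re (cis_quotient (u ^ m) \<beta>))
     + (\<Sum>k<n. (real n - 2 * real k - 1) / (2 * real n) * (2 * \<alpha> / u * Re (cis_quotient (u powr \<alpha>) (\<psi> k))))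
     + (\<Sum>j<m. (real m - 2 * real j - 1) / (2 * real m) * (2 * 1 / u * Re (cis_quotient u (\<eta> j))))) (at u)"
    unfolding log_rhs_def
    by (intro DERIV_add DERIV_diff DERIV_sum DERIV_cmult DERIV_cdivide D0 D1 D2 DK)
  also have "(\<Sum>j<m. (real m - 2 * real j - 1) / (2 * real m) * (2 * 1 / u * Re (cis_quotient u (\<eta> j))))
     = (\<Sum>j<m. (2 * real j + 1 - real m) / (real m * u) * Re (cis_quotient u (pi * \<rho> - pi * (2 * real j + 1) / \<alpha>)))"
    \<comment> \<open>The reversal \<open>j \<mapsto> m - 1 - j\<close> replaces \<open>q j\<close> by its conjugate, because the angles
        \<open>pi (2 j + 1) / \<alpha>\<close> of the two indices add up to \<open>2 pi n\<close>.\<close>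
  proof (subst sum.nat_diff_reindex[symmetric], rule sum.cong)
    fix j assume "j \<in> {..<m}"
    then have j: "real (m - Suc j) = real m - real j - 1" by auto
    have "\<eta> (m - Suc j) = pi * \<rho> - pi * (2 * real j + 1) / \<alpha> + 2 * pi * real n"
      unfolding \<eta>_def j using ap m n by (simp add: \<alpha> field_simps)
    then have "cis_quotient u (\<eta> (m - Suc j)) = cis_quotient u (pi * \<rho> - pi * (2 * real j + 1) / \<alpha>)"
      by (simp add: cis_quotient_def cis_mult[symmetric])
    then show "(real m - 2 * real (m - Suc j) - 1) / (2 * real m) * (2 * 1 / u * Re (cis_quotient u (\<eta> (m - Suc j))))
       = (2 * real j + 1 - real m) / (real m * u) * Re (cis_quotient u (pi * \<rho> - pi * (2 * real j + 1) / \<alpha>))"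
      unfolding j using m u by (simp add: field_simps)
  qed simp
  also have "(2 * real m * real m * ln u / u * Im (cis_quotient (u ^ m) \<beta>)) / (2 * pi * real m * real n)
     = (\<Sum>k<n. real m * ln u / (real n * real n * pi * u) * Im (cis_quotient (u powr \<alpha>) (\<psi> k)))"
  proof -
    have S: "(\<Sum>k<n. Im (cis_quotient (u powr \<alpha>) (\<psi> k))) = real n * Im (cis_quotient (u ^ m) \<beta>)"
      using arg_cong[OF sum_cis_quotient_roots[OF m n mn u \<alpha>, of \<rho>], of Im] by (simp add: \<psi>_def \<beta>_def)
    show ?thesis unfolding sum_distrib_left[symmetric] S using m n by simp
  qed
  also have "\<rho> / (2 * real n) * (2 * real m / u * Re (cis_quotient (u ^ m) \<beta>))
     = (\<Sum>k<n. \<rho> * real m / (real n * real n * u) * Re (cis_quotient (u powr \<alpha>) (\<psi> k)))"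
  proof -
    have S: "(\<Sum>k<n. Re (cis_quotient (u powr \<alpha>) (\<psi> k))) = real n * Re (cis_quotient (u ^ m) \<beta>)"
      using arg_cong[OF sum_cis_quotient_roots[OF m n mn u \<alpha>, of \<rho>], of Re] by (simp add: \<psi>_def \<beta>_def)
    show ?thesis unfolding sum_distrib_left[symmetric] S using m n by simp
  qed
  also have "(\<Sum>k<n. real m * ln u / (real n * real n * pi * u) * Im (cis_quotient (u powr \<alpha>) (\<psi> k)))
      - (\<Sum>k<n. \<rho> * real m / (real n * real n * u) * Re (cis_quotient (u powr \<alpha>) (\<psi> k)))
      + (\<Sum>k<n. (real n - 2 * real k - 1) / (2 * real n) * (2 * \<alpha> / u * Re (cis_quotient (u powr \<alpha>) (\<psi> k))))
      = (\<Sum>k<n. - (real m / (real n * pi * u)) * (pi * (\<rho> + 2 * real k + 1 - real n) / real n * Re (cis_quotient (u powr \<alpha>) (\<psi> k))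
             - ln u / real n * Im (cis_quotient (u powr \<alpha>) (\<psi> k))))"
    unfolding sum_subtractf[symmetric] sum.distrib[symmetric]
  proof (rule sum.cong)
    fix k
    have "M * l / (N * N * pi * u) * b - r * M / (N * N * u) * a + (N - 2 * K - 1) / (2 * N) * (2 * (M / N) / u * a)
       = - (M / (N * pi * u)) * (pi * (r + 2 * K + 1 - N) / N * a - l / N * b)"
      if "N > 0" for M N l b r a K :: real
      using that u by (simp add: field_simps)
    from this[of "real n"] show "real m * ln u / (real n * real n * pi * u) * Im (cis_quotient (u powr \<alpha>) (\<psi> k))
      - \<rho> * real m / (real n * real n * u) * Re (cis_quotient (u powr \<alpha>) (\<psi> k))
      + (real n - 2 * real k - 1) / (2 * real n) * (2 * \<alpha> / u * Re (cis_quotient (u powr \<alpha>) (\<psi> k)))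
      = - (real m / (real n * pi * u)) * (pi * (\<rho> + 2 * real k + 1 - real n) / real n * Re (cis_quotient (u powr \<alpha>) (\<psi> k))
             - ln u / real n * Im (cis_quotient (u powr \<alpha>) (\<psi> k)))"
      using n unfolding \<alpha> by simp
  qed simp
  also have "\<dots> + (\<Sum>j<m. (2 * real j + 1 - real m) / (real m * u) * Re (cis_quotient u (pi * \<rho> - pi * (2 * real j + 1) / \<alpha>)))
     = - sin (pi * \<rho>) / (pi * u) * fermi_integral \<alpha> \<rho> u"
  proof -
    define A where "A = (\<Sum>k<n. pi * (\<rho> + 2 * real k + 1 - real n) / real n * Re (cis_quotient (u powr \<alpha>) (\<psi> k))
             - ln u / real n * Im (cis_quotient (u powr \<alpha>) (\<psi> k)))"
    define B where "B = (\<Sum>j<m. pi * (2 * real j + 1 - real m) / real m * Re (cis_quotient u (pi * \<rho> - pi * (2 * real j + 1) / \<alpha>)))"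
    have Jf: "fermi_integral \<alpha> \<rho> u = real m / (real n * sin (pi * \<rho>)) * (A - real n / real m * B)"
      using fermi_integral_formula[OF m n \<rho> u] unfolding A_def B_def \<psi>_def \<alpha> .
    have S: "(\<Sum>j<m. (2 * real j + 1 - real m) / (real m * u) * Re (cis_quotient u (pi * \<rho> - pi * (2 * real j + 1) / \<alpha>))) = B / (pi * u)"
      unfolding B_def sum_divide_distrib using u by (intro sum.cong refl) simp
    show ?thesis
      unfolding sum_distrib_left[symmetric] A_def[symmetric] S Jf
      using m n u sin_pi_pos[OF \<rho>] by (simp add: field_simps)
  qed
  finally show ?thesis .
qed

section \<open>Continuity, reciprocity and conclusion\<close>

lemma isCont_theta: "isCont (theta arccot m n \<rho>) z"
proof (cases "real m * \<rho> \<in> \<int>")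
  case True
  then have "theta arccot m n \<rho> = (\<lambda>z. 0)" by (intro ext) (simp add: theta_def)
  then show ?thesis by simp
next
  case False
  then have "theta arccot m n \<rho> = (\<lambda>z. pi / 2 - arctan (cot (pi * real m * \<rho>) + (- 1) ^ (m * n) * z ^ m / sin (pi * real m * \<rho>)))"
    by (intro ext) (simp add: theta_def arccot_def)
  moreover have "sin (pi * real m * \<rho>) \<noteq> 0"
    using False by (simp only: sin_pi_times_eq_0_iff not_False_eq_True)
  ultimately show ?thesis by (auto intro!: continuous_intros)
qed

lemma isCont_clausen_part: "isCont (clausen_part arccot m n \<rho>) z"
proof -
  have C: "isCont Cl2 x" for x
    using continuous_Cl2 by (simp add: continuous_on_eq_continuous_at)
  show ?thesis unfolding clausen_part_def
    by (intro continuous_diff continuous_const isCont_o2[OF _ C] continuous_mult isCont_theta)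
qed

lemma isCont_log_rhs:
  assumes "z > 0" "\<not> some_factor_vanishes m n \<alpha> \<rho> z"
  shows "isCont (log_rhs m n \<alpha> \<rho>) z"
proof -
  have ne: "factor0 m n \<rho> z \<noteq> 0" "\<And>k. k < n \<Longrightarrow> factor1 \<alpha> \<rho> k z \<noteq> 0" "\<And>j. j < m \<Longrightarrow> factor2 \<alpha> \<rho> j z \<noteq> 0"
    using assms(2) by (auto simp: some_factor_vanishes_def)
  have f0: "isCont (\<lambda>z. ln (factor0 m n \<rho> z)) z"
    using ne(1) unfolding factor0_def by (intro isCont_ln' continuous_intros)
  have f1: "isCont (\<lambda>z. ln (factor1 \<alpha> \<rho> k z)) z" if "k < n" for k
    using ne(2)[OF that] assms(1) unfolding factor1_def by (intro isCont_ln' continuous_intros) auto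
  have f2: "isCont (\<lambda>z. ln (factor2 \<alpha> \<rho> j z)) z" if "j < m" for j
    using ne(3)[OF that] unfolding factor2_def by (intro isCont_ln' continuous_intros)
  have d: "isCont (\<lambda>z. clausen_part arccot m n \<rho> z / (2 * pi * real m * real n)) z"
    unfolding divide_inverse by (intro continuous_mult continuous_const isCont_clausen_part)
  show ?thesis unfolding log_rhs_def
    by (intro continuous_add continuous_diff continuous_sum continuous_mult continuous_const d f0 f1 f2) auto
qed

text \<open>
  For \<open>z = 0\<close> the angle is \<open>pi m \<rho>\<close> modulo \<open>pi\<close>.
\<close>

lemma clausen_part_0:
  assumes "m > 0" shows "clausen_part arccot m n \<rho> 0 = 0"
proof -
  have "sin (theta arccot m n \<rho> 0 - pi * real m * \<rho>) = 0"
  proof (cases "real m * \<rho> \<in> \<int>")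
    case True
    then have "sin (pi * real m * \<rho>) = 0" by (simp only: sin_pi_times_eq_0_iff)
    with True show ?thesis by (simp add: theta_def)
  next
    case False
    from theta_arccot_sin(2)[OF this, of n 0] assms show ?thesis by simp
  qed
  note * = sin_diff_0_imp_Cl2_eq[OF this]
  show ?thesis using *[of 0] *[of "2 * pi * real m * \<rho>"]
    by (simp add: clausen_part_def Cl2_0 mult.assoc)
qed

lemma log_rhs_tendsto_0:
  assumes "m > 0" "n > 0" "\<alpha> > 0"
  shows "(log_rhs m n \<alpha> \<rho> \<longlongrightarrow> 0) (at_right 0)"
proof -
  have K: "(clausen_part arccot m n \<rho> \<longlongrightarrow> 0) (at_right 0)"
    using isCont_clausen_part[of 0 m n \<rho>] clausen_part_0[OF assms(1)]
    by (auto simp: isCont_def intro: filterlim_at_split[THEN iffD1, THEN conjunct2])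
  have id: "((\<lambda>z::real. z) \<longlongrightarrow> 0) (at_right 0)" by (rule tendsto_ident_at)
  have pw: "((\<lambda>z::real. z powr \<alpha>) \<longlongrightarrow> 0) (at_right 0)"
    using assms by (intro tendsto_zero_powrI[OF id tendsto_const]) (auto simp: eventually_at_right_less eventually_at_filter)
  have pn: "((\<lambda>z::real. z ^ m) \<longlongrightarrow> 0) (at_right 0)"
    using tendsto_power[OF id, of m] assms by simp
  have q: "((\<lambda>z. ln (1 + 2 * c * t z + (t z)\<^sup>2)) \<longlongrightarrow> 0) (at_right 0)" if t: "(t \<longlongrightarrow> 0) (at_right 0)" for c and t :: "real \<Rightarrow> real"
  proof -
    have "((\<lambda>z. ln (1 + 2 * c * t z + (t z)\<^sup>2)) \<longlongrightarrow> ln (1 + 2 * c * 0 + 0\<^sup>2)) (at_right 0)"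
      by (intro tendsto_ln tendsto_add tendsto_mult tendsto_const tendsto_power t) auto
    then show ?thesis by simp
  qed
  have "(log_rhs m n \<alpha> \<rho> \<longlongrightarrow> 0 / (2 * pi * real m * real n) - \<rho> / (2 * real n) * 0
     + (\<Sum>k<n. (real n - 2 * real k - 1) / (2 * real n) * 0)
     + (\<Sum>j<m. (real m - 2 * real j - 1) / (2 * real m) * 0)) (at_right 0)"
    unfolding log_rhs_def factor0_quadratic factor1_quadratic factor2_def
    by (intro tendsto_add tendsto_diff tendsto_sum tendsto_mult[OF tendsto_const] tendsto_divide K q id pn pw tendsto_const)
       (use assms in auto)
  then show ?thesis by simp
qed

lemma sum_centred_weights: "(\<Sum>k<n. real n - 2 * real k - 1) = 0"
proof -
  have "(\<Sum>k<n. 2 * real k + 1) = real n * real n"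
    by (induction n) (simp_all add: algebra_simps)
  moreover have "(\<Sum>k<n. real n - 2 * real k - 1) = (\<Sum>k<n. real n) - (\<Sum>k<n. 2 * real k + 1)"
    by (subst sum_subtractf[symmetric]) (simp add: algebra_simps)
  ultimately show ?thesis by simp
qed

text \<open>
  If \<open>\<theta>\<close> belongs to \<open>z\<close>, then \<open>\<beta> - \<theta>\<close> belongs to \<open>1/z\<close>, because this reflection inverts
  the quotient \<open>sin (\<theta> - \<beta>) / sin \<theta>\<close>. It exchanges the two Clausen terms that depend on
  \<open>\<theta>\<close>, and the Clausen function is odd.
\<close>

lemma clausen_part_reciprocal:
  assumes "z > 0" shows "clausen_part arccot m n \<rho> (1 / z) = clausen_part arccot m n \<rho> z"
proof (cases "real m * \<rho> \<in> \<int>")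
  case True then show ?thesis by (simp add: clausen_part_def theta_def)
next
  case False
  define \<beta> where "\<beta> = pi * real m * \<rho>"
  define \<epsilon> :: real where "\<epsilon> = (- 1) ^ (m * n)"
  define t where "t = theta arccot m n \<rho> z"
  define t' where "t' = theta arccot m n \<rho> (1 / z)"
  have \<epsilon>: "\<epsilon> * \<epsilon> = 1" "\<epsilon> \<noteq> 0" by (simp_all add: \<epsilon>_def power_mult_distrib[symmetric])
  have s\<beta>: "sin \<beta> \<noteq> 0"
    using False unfolding \<beta>_def by (simp only: sin_pi_times_eq_0_iff not_False_eq_True)
  have t: "sin t \<noteq> 0" "sin (t - \<beta>) = - (\<epsilon> * z ^ m) * sin t"
    and t': "sin t' \<noteq> 0" "sin (t' - \<beta>) = - (\<epsilon> / z ^ m) * sin t'"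
    using theta_arccot_sin[OF False, of n z] theta_arccot_sin[OF False, of n "1/z"]
    by (simp_all add: t_def t'_def \<beta>_def \<epsilon>_def power_divide)
  have bt: "sin (\<beta> - t) = \<epsilon> * z ^ m * sin t" using t(2) sin_minus[of "t - \<beta>"] by simp
  then have bt0: "sin (\<beta> - t) \<noteq> 0" using t(1) \<epsilon>(2) assms by simp
  have "sin ((\<beta> - t) - \<beta>) = - (\<epsilon> / z ^ m) * sin (\<beta> - t)"
    unfolding bt using \<epsilon>(1) assms by (simp add: field_simps)
  then have "cot (\<beta> - t) = cot t'"
    using cot_shift_iff[OF bt0 s\<beta>] cot_shift_iff[OF t'(1) s\<beta>] t'(2) by metis
  then have "sin (t' - (\<beta> - t)) = 0"
    by (intro cot_eq_imp_sin_diff_0 t' bt0) simp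
  note * = sin_diff_0_imp_Cl2_eq[OF this]
  have "Cl2 (2 * t') - Cl2 (2 * \<beta>) - Cl2 (2 * t' - 2 * \<beta>) = Cl2 (2 * (\<beta> - t)) - Cl2 (2 * \<beta>) - Cl2 (2 * (\<beta> - t) - 2 * \<beta>)"
    using *[of 0] *[of "2 * \<beta>"] by simp
  also have "\<dots> = Cl2 (2 * t) - Cl2 (2 * \<beta>) - Cl2 (2 * t - 2 * \<beta>)"
    using Cl2_minus[of "2 * t"] Cl2_minus[of "2 * t - 2 * \<beta>"] by (simp add: algebra_simps)
  finally show ?thesis by (simp add: clausen_part_def t_def t'_def \<beta>_def mult.assoc)
qed

text \<open>
  Each factor is reciprocal up to a power of \<open>z\<close>. The exponents of \<open>factor1\<close> and \<open>factor2\<close>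
  sum to 0, so only the power of \<open>factor0\<close> leaves a trace.
\<close>

lemma log_rhs_reciprocal:
  assumes z: "z > 0" "z \<noteq> 1" and mn: "m > 0" "n > 0" and \<alpha>: "\<alpha> = real m / real n"
  shows "log_rhs m n \<alpha> \<rho> (1 / z) = log_rhs m n \<alpha> \<rho> z + \<alpha> * \<rho> * ln z"
proof -
  have ap: "\<alpha> > 0" using mn \<alpha> by simp
  note pos = factors_pos[OF z mn(1) ap]
  have q: "ln (1 + 2 * c * (1 / t) + (1 / t)\<^sup>2) = ln (1 + 2 * c * t + t\<^sup>2) - 2 * ln t"
    if "t > 0" "1 + 2 * c * t + t\<^sup>2 > 0" for c t :: real
  proof -
    have "1 + 2 * c * (1 / t) + (1 / t)\<^sup>2 = (1 + 2 * c * t + t\<^sup>2) / t\<^sup>2"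
      using that by (simp add: field_simps power2_eq_square)
    then show ?thesis using that by (simp add: ln_div ln_realpow)
  qed
  have f0: "ln (factor0 m n \<rho> (1 / z)) = ln (factor0 m n \<rho> z) - 2 * real m * ln z"
    using q[of "z ^ m" "(- 1) ^ (m * n) * cos (pi * real m * \<rho>)"] pos(1)[of n \<rho>] z
    by (simp add: factor0_quadratic power_divide ln_realpow)
  have f1: "ln (factor1 \<alpha> \<rho> k (1 / z)) = ln (factor1 \<alpha> \<rho> k z) - 2 * \<alpha> * ln z" for k
    using q[of "z powr \<alpha>" "cos (pi * \<alpha> * (\<rho> + 2 * real k + 1))"] pos(2)[of \<rho> k] z
    by (simp add: factor1_quadratic powr_divide ln_powr)
  have f2: "ln (factor2 \<alpha> \<rho> j (1 / z)) = ln (factor2 \<alpha> \<rho> j z) - 2 * ln z" for j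
    using q[of z "cos (pi / \<alpha> * (\<alpha> * \<rho> + 2 * real j + 1))"] pos(3)[of \<rho> j] z
    unfolding factor2_def by simp
  have "(\<Sum>k<N. w k / d * (a k - b)) = (\<Sum>k<N. w k / d * a k) - (\<Sum>k<N. w k) / d * b"
    for w a :: "nat \<Rightarrow> real" and d b N
    by (simp add: right_diff_distrib sum_subtractf sum_divide_distrib sum_distrib_right)
  note shift = this[of "\<lambda>k. real N - 2 * real k - 1" "2 * real N" _ _ N for N, unfolded sum_centred_weights]
  show ?thesis
    unfolding log_rhs_def f0 f1 f2 shift clausen_part_reciprocal[OF z(1)]
    using mn by (simp add: \<alpha> right_diff_distrib)
qed

lemma integral_from_0:
  fixes g :: "real \<Rightarrow> real"
  assumes cont: "continuous_on {0<..} g" and c: "c > 0" "set_integrable lborel {0<..<c} g" and z: "z > 0"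
  shows "((\<lambda>z. LINT u:{0<..<z}|lborel. g u) has_field_derivative g z) (at z)"
proof -
  define a b where "a = z / 2" and "b = 2 * z"
  have ab: "0 < a" "a < z" "z < b" using z by (auto simp: a_def b_def)
  have int: "set_integrable lborel {0<..<b} g"
  proof (rule set_integrable_subset)
    have "set_integrable lborel {c/2..b} g"
      by (rule borel_integrable_atLeastAtMost') (rule continuous_on_subset[OF cont], use c in auto)
    with c(2) show "set_integrable lborel ({0<..<c} \<union> {c/2..b}) g"
      by (rule set_integrable_Un) auto
  qed (use c in auto)
  have eq: "(LINT u:{0<..<y}|lborel. g u) = (LINT u:{0<..<a}|lborel. g u) + (LBINT u=a..y. g u)" if "y \<in> {a<..<b}" for y
  proof -
    have "interval_lebesgue_integrable lborel (ereal 0) (ereal y) g"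
      using that ab by (auto simp: interval_lebesgue_integrable_def intro: set_integrable_subset[OF int])
    then have "(LBINT u=ereal 0..ereal a. g u) + (LBINT u=ereal a..ereal y. g u) = (LBINT u=ereal 0..ereal y. g u)"
      using that ab by (intro interval_integral_sum) (simp add: min_def max_def)
    then show ?thesis using that ab by (simp add: interval_integral_Ioo)
  qed
  have "((\<lambda>y. LBINT u=ereal a..ereal y. g u) has_vector_derivative g z) (at z within {a..b})"
    using ab by (intro interval_integral_FTC2 continuous_on_subset[OF cont]) auto
  then have "((\<lambda>y. LBINT u=ereal a..ereal y. g u) has_vector_derivative g z) (at z)"
    using at_within_Icc_at[OF ab(2,3)] by simp
  then have "((\<lambda>y. (LINT u:{0<..<a}|lborel. g u) + (LBINT u=a..y. g u)) has_field_derivative 0 + g z) (at z)"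
    unfolding has_real_derivative_iff_has_vector_derivative by (intro has_vector_derivative_add has_vector_derivative_const)
  then have "((\<lambda>y. (LINT u:{0<..<a}|lborel. g u) + (LBINT u=a..y. g u)) has_field_derivative g z) (at z)"
    by (simp only: add_0_left)
  then show ?thesis
  proof (rule has_field_derivative_transform_within_open)
    show "open {a<..<b}" "z \<in> {a<..<b}" using ab by auto
  qed (rule eq[symmetric])
qed

text \<open>
  The exponent in the definition of \<open>\<phi>\<close>, in the real form provided by \<open>F_difference\<close>.
\<close>

definition log_phi :: "real \<Rightarrow> real \<Rightarrow> real \<Rightarrow> real" where
  "log_phi \<alpha> \<rho> z = (LINT u:{0<..<z}|lborel. - sin (pi * \<rho>) / (pi * u) * fermi_integral \<alpha> \<rho> u)"

lemma phi_eq_exp_log_phi: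
  assumes "0 < \<rho>" "\<rho> < 1" "\<alpha> > 0"
  shows "\<phi> z \<alpha> \<rho> = complex_of_real (exp (log_phi \<alpha> \<rho> z))"
proof -
  have "(LINT u:{0<..<z}|lborel. 1 / (2 * complex_of_real pi * \<i> * complex_of_real u) *
       (F (complex_of_real pi * \<i> * complex_of_real \<rho> - complex_of_real (ln u)) \<alpha>
        - F (- (complex_of_real pi * \<i> * complex_of_real \<rho>) - complex_of_real (ln u)) \<alpha>))
     = (LINT u:{0<..<z}|lborel. complex_of_real (- sin (pi * \<rho>) / (pi * u) * fermi_integral \<alpha> \<rho> u))"
    by (rule set_lebesgue_integral_cong) (use F_difference[OF assms] in auto)
  also have "\<dots> = complex_of_real (log_phi \<alpha> \<rho> z)"
    unfolding log_phi_def by (rule set_integral_complex_of_real)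
  finally show ?thesis unfolding \<phi>_def by (simp only: exp_of_real)
qed

text \<open>
  On \<open>(0, 1)\<close> the two functions have the same derivative and the same limit 0 at 0; the
  integrand has a constant sign, so the existence of that limit also yields its
  integrability near 0. At 1 the logarithms in \<open>log_rhs\<close> may be singular, and the
  identity cannot be continued across this point by differentiation. Instead both sides
  satisfy the functional equation \<open>L z = L (1/z) - \<alpha> \<rho> ln z\<close>, which carries it over to
  \<open>(1, \<infinity>)\<close>.
\<close>

lemma log_phi_eq_log_rhs:
  fixes m n :: nat
  assumes m: "m > 0" and n: "n > 0" and mn: "coprime m n" and \<rho>: "0 < \<rho>" "\<rho> < 1"
    and \<alpha>: "\<alpha> = real m / real n"
  shows "z > 0 \<Longrightarrow> z \<noteq> 1 \<Longrightarrow> log_phi \<alpha> \<rho> z = log_rhs m n \<alpha> \<rho> z"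
    and "z > 0 \<Longrightarrow> isCont (log_phi \<alpha> \<rho>) z"
proof -
  have ap: "\<alpha> > 0" using m n \<alpha> by simp
  define s where "s = sin (pi * \<rho>)"
  have s: "s > 0" using sin_pi_pos[OF \<rho>] by (simp add: s_def)
  define g where "g u = - s / (pi * u) * fermi_integral \<alpha> \<rho> u" for u
  have cont: "continuous_on {0<..} g" unfolding g_def
    by (intro continuous_intros continuous_fermi_integral \<rho> ap) auto
  have isC: "isCont g u" if "u > 0" for u
    using cont that by (simp add: continuous_on_eq_continuous_at)
  have small: "set_integrable lborel {0<..<z} g" "log_phi \<alpha> \<rho> z = log_rhs m n \<alpha> \<rho> z" if z: "0 < z" "z < 1" for z
  proof -
    have d: "(log_rhs m n \<alpha> \<rho> has_field_derivative g u) (at u)" if "0 < u" "u < 1" for u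
      unfolding g_def s_def by (rule log_rhs_deriv[OF m n mn \<rho> _ _ \<alpha>]) (use that in auto)
    have deriv: "((\<lambda>u. - log_rhs m n \<alpha> \<rho> u) has_field_derivative - g u) (at u)" if "ereal 0 < ereal u" "ereal u < ereal z" for u
      using that z by (intro DERIV_minus d) auto
    have cont': "isCont (\<lambda>u. - g u) u" if "ereal 0 < ereal u" "ereal u < ereal z" for u
      using that by (intro continuous_minus isC) auto
    have nonneg: "AE u in lborel. ereal 0 < ereal u \<longrightarrow> ereal u < ereal z \<longrightarrow> 0 \<le> - g u"
      using s fermi_integral_nonneg[OF \<rho>] by (intro always_eventually) (auto simp: g_def)
    have lim0: "(((\<lambda>u. - log_rhs m n \<alpha> \<rho> u) \<circ> real_of_ereal) \<longlongrightarrow> - 0) (at_right (ereal 0))"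
      unfolding ereal_tendsto_simps by (intro tendsto_minus log_rhs_tendsto_0 m n ap)
    have "isCont (log_rhs m n \<alpha> \<rho>) z" using d[OF z] by (rule DERIV_isCont)
    then have "(log_rhs m n \<alpha> \<rho> \<longlongrightarrow> log_rhs m n \<alpha> \<rho> z) (at_left z)"
      by (simp add: isCont_def filterlim_at_split)
    then have limz: "(((\<lambda>u. - log_rhs m n \<alpha> \<rho> u) \<circ> real_of_ereal) \<longlongrightarrow> - log_rhs m n \<alpha> \<rho> z) (at_left (ereal z))"
      unfolding ereal_tendsto_simps by (intro tendsto_minus)
    have "ereal 0 < ereal z" using z by simp
    note F = interval_integral_FTC_nonneg[OF this deriv cont' nonneg lim0 limz]
    show 1: "set_integrable lborel {0<..<z} g"
      using F(1) by (simp add: set_integrable_def)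
    have "(LINT u:{0<..<z}|lborel. - g u) = (LBINT u=ereal 0..ereal z. - g u)"
      using z by (subst interval_integral_Ioo) auto
    also note F(2)
    finally have "(LINT u:{0<..<z}|lborel. - g u) = - log_rhs m n \<alpha> \<rho> z" by (simp only: minus_zero diff_0_right)
    then have "(LINT u:{0<..<z}|lborel. g u) = log_rhs m n \<alpha> \<rho> z"
      by (simp add: set_lebesgue_integral_def)
    then show "log_phi \<alpha> \<rho> z = log_rhs m n \<alpha> \<rho> z" by (simp add: log_phi_def g_def s_def)
  qed
  have d: "(log_phi \<alpha> \<rho> has_field_derivative g z) (at z)" if "z > 0" for z
    using integral_from_0[OF cont _ small(1)[of "1/2"] that]
    by (simp add: log_phi_def[abs_def] g_def s_def)
  show "isCont (log_phi \<alpha> \<rho>) z" if "z > 0" for z by (rule DERIV_isCont[OF d[OF that]])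
  have symm: "log_phi \<alpha> \<rho> z = log_phi \<alpha> \<rho> (1 / z) - \<alpha> * \<rho> * ln z" if z: "z > 0" for z
  proof -
    define D where "D z = log_phi \<alpha> \<rho> z - log_phi \<alpha> \<rho> (1 / z) + \<alpha> * \<rho> * ln z" for z
    have "\<exists>c. \<forall>x\<in>{0<..}. D x = c"
    proof (rule has_field_derivative_zero_constant)
      fix x :: real assume "x \<in> {0<..}"
      then have x: "x > 0" by simp
      have "((\<lambda>x. log_phi \<alpha> \<rho> (1 / x)) has_field_derivative g (1 / x) * (- 1 / x\<^sup>2)) (at x)"
        by (rule DERIV_chain2[OF d]) (use x in \<open>auto intro!: derivative_eq_intros simp: power2_eq_square\<close>)
      then have "(D has_field_derivative g x - g (1 / x) * (- 1 / x\<^sup>2) + \<alpha> * \<rho> * (1 / x)) (at x)"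
        unfolding D_def using x by (intro DERIV_add DERIV_diff DERIV_cmult d DERIV_ln_divide)
      also have "g x - g (1 / x) * (- 1 / x\<^sup>2) + \<alpha> * \<rho> * (1 / x) = - s / (pi * x) * (fermi_integral \<alpha> \<rho> x + fermi_integral \<alpha> \<rho> (1 / x)) + \<alpha> * \<rho> / x"
        using x by (simp add: g_def power2_eq_square field_simps)
      also have "\<dots> = 0" unfolding fermi_integral_reciprocal[OF \<rho> ap x] s_def[symmetric] using s x by simp
      finally show "(D has_field_derivative 0) (at x within {0<..})" by (rule has_field_derivative_at_within)
    qed simp
    then have "D z = D 1" using z by auto
    then show ?thesis by (simp add: D_def)
  qed
  show "log_phi \<alpha> \<rho> z = log_rhs m n \<alpha> \<rho> z" if z: "z > 0" "z \<noteq> 1" for z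
  proof (cases "z < 1")
    case True with z small(2) show ?thesis by simp
  next
    case False
    then have "log_phi \<alpha> \<rho> (1 / z) = log_rhs m n \<alpha> \<rho> (1 / z)" using z by (intro small(2)) auto
    with symm[OF z(1)] log_rhs_reciprocal[OF z m n \<alpha>, of \<rho>] show ?thesis by simp
  qed
qed

theorem theorem2:
  fixes m n :: nat and \<alpha> \<rho> z :: real and acot :: "real \<Rightarrow> real"
  assumes "m > 0" and "n > 0" and "coprime m n"
    and "\<alpha> = real m / real n"
    and "0 < \<rho>" and "\<rho> < 1"
    and "cot_inverse acot"
    and "z > 0"
  shows "(\<not> some_factor_vanishes m n \<alpha> \<rho> z \<longrightarrow>
            \<phi> z \<alpha> \<rho> = complex_of_real (phi_rhs acot m n \<alpha> \<rho> z))
       \<and> (some_factor_vanishes m n \<alpha> \<rho> z \<longrightarrow>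
            ((\<lambda>y. complex_of_real (phi_rhs acot m n \<alpha> \<rho> y)) \<longlongrightarrow> \<phi> z \<alpha> \<rho>) (at z))"
proof -
  have ap: "\<alpha> > 0" using assms by simp
  note L = log_phi_eq_log_rhs[OF assms(1-3,5,6,4)]
  note phi = phi_eq_exp_log_phi[OF assms(5,6) ap]
  have no_vanish: "\<not> some_factor_vanishes m n \<alpha> \<rho> y" if "y > 0" "y \<noteq> 1" for y
    unfolding some_factor_vanishes_def using factors_pos[OF that assms(1) ap] by (metis less_irrefl)
  have rhs: "phi_rhs acot m n \<alpha> \<rho> y = exp (log_phi \<alpha> \<rho> y)" if "y > 0" "y \<noteq> 1" for y
    using phi_rhs_eq_exp_log_rhs[OF assms(7) that(1) no_vanish[OF that]] L(1)[OF that] by simp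
  show ?thesis
  proof (intro conjI impI)
    assume nv: "\<not> some_factor_vanishes m n \<alpha> \<rho> z"
    have "log_phi \<alpha> \<rho> z = log_rhs m n \<alpha> \<rho> z"
    proof (cases "z = 1")
      case False with L(1) assms(8) show ?thesis by simp
    next
      case True
      have "log_phi \<alpha> \<rho> \<midarrow>z\<rightarrow> log_phi \<alpha> \<rho> z"
        using L(2)[OF assms(8)] by (simp add: isCont_def)
      moreover have "eventually (\<lambda>y. log_phi \<alpha> \<rho> y = log_rhs m n \<alpha> \<rho> y) (at z)"
        unfolding eventually_at by (rule exI[of _ 1]) (use L(1) True in \<open>auto simp: dist_real_def\<close>)
      ultimately have "log_rhs m n \<alpha> \<rho> \<midarrow>z\<rightarrow> log_phi \<alpha> \<rho> z" by (simp add: tendsto_cong)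
      moreover have "log_rhs m n \<alpha> \<rho> \<midarrow>z\<rightarrow> log_rhs m n \<alpha> \<rho> z"
        using isCont_log_rhs[OF assms(8) nv] by (simp add: isCont_def)
      ultimately show ?thesis by (rule LIM_unique)
    qed
    then show "\<phi> z \<alpha> \<rho> = complex_of_real (phi_rhs acot m n \<alpha> \<rho> z)"
      unfolding phi phi_rhs_eq_exp_log_rhs[OF assms(7,8) nv] by simp
  next
    assume "some_factor_vanishes m n \<alpha> \<rho> z"
    then have z1: "z = 1" using no_vanish assms(8) by blast
    have "(\<lambda>y. complex_of_real (exp (log_phi \<alpha> \<rho> y))) \<midarrow>z\<rightarrow> \<phi> z \<alpha> \<rho>"
      unfolding phi using L(2)[OF assms(8)] by (intro tendsto_intros) (simp add: isCont_def)
    moreover have "eventually (\<lambda>y. complex_of_real (exp (log_phi \<alpha> \<rho> y)) = complex_of_real (phi_rhs acot m n \<alpha> \<rho> y)) (at z)"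
      unfolding eventually_at by (rule exI[of _ 1]) (use rhs z1 in \<open>auto simp: dist_real_def\<close>)
    ultimately show "((\<lambda>y. complex_of_real (phi_rhs acot m n \<alpha> \<rho> y)) \<longlongrightarrow> \<phi> z \<alpha> \<rho>) (at z)"
      by (rule Lim_transform_eventually)
  qed
qed

end
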